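(* Fix finitely many sequences $\{T^{(1)}_n\}_{n\ge1},\ldots,\{T^{(N)}_n\}_{n\ge1}$, where each $T^{(i)}_n$ is a graph or a graphon. Then there exist even cycles $G,H$ such that for every $1\leq i\leq N$, the sequence $\frac{\log t(G,T^{(i)}_n)}{\log t(H,T^{(i)}_n)}$ does not converge to $C(G,H)$ as $n\to\infty$.
   Context: All graphs are finite and simple. $\operatorname{hom}(H,T)$ is the number of maps $V(H)\to V(T)$ sending every edge of $H$ to an edge of $T$, and $t(H,T)=\operatorname{hom}(H,T)/v(T)^{v(H)}$ (for a graphon $W$, $t(H,W)$ is the usual homomorphism density of $H$ in $W$). The homomorphism density domination exponent is $C(G,H)=\min\{c\in\mathbb{R}: t(G,T)\geq t(H,T)^c \text{ for all graphs } T\}$; equivalently $C(G,H)=\sup_{0<t(H,T)<1}\frac{\log t(G,T)}{\log t(H,T)}$. *)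

theory Defs
  imports "HOL-Analysis.Analysis" "Graph_Theory.Pair_Digraph"
begin

text \<open>
  A finite simple graph is a \<^const>\<open>pair_graph\<close>: a finite vertex set with a finite, symmetric,
  loop-free set of ordered pairs, in which every undirected edge occurs in both orientations.
\<close>

definition hom_count :: "'a pair_pre_digraph \<Rightarrow> 'b pair_pre_digraph \<Rightarrow> nat" where
  "hom_count H T =
     card {f \<in> pverts H \<rightarrow>\<^sub>E pverts T. \<forall>u v. (u, v) \<in> parcs H \<longrightarrow> (f u, f v) \<in> parcs T}"

definition graph_density :: "'a pair_pre_digraph \<Rightarrow> 'b pair_pre_digraph \<Rightarrow> real" where
  "graph_density H T = real (hom_count H T) / real (card (pverts T)) ^ card (pverts H)"

definition graphon :: "(real \<Rightarrow> real \<Rightarrow> real) \<Rightarrow> bool" where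
  "graphon W \<longleftrightarrow>
     (\<lambda>(x, y). W x y) \<in> borel_measurable (lebesgue_on ({0..1} \<times> {0..1})) \<and>
     (\<forall>x\<in>{0..1}. \<forall>y\<in>{0..1}. W x y = W y x \<and> 0 \<le> W x y \<and> W x y \<le> 1)"

text \<open>
  The integral is over the cube \<open>[0,1]\<^bsup>V(H)\<^esup>\<close> with Lebesgue measure. The completion is needed because
  graphons are Lebesgue (not necessarily Borel) measurable. The condition \<open>u < v\<close> makes each
  undirected edge contribute exactly one factor.
\<close>

definition graphon_density ::
    "'a::linorder pair_pre_digraph \<Rightarrow> (real \<Rightarrow> real \<Rightarrow> real) \<Rightarrow> real" where
  "graphon_density H W =
     (\<integral>x. (\<Prod>(u, v)\<in>{(u, v). (u, v) \<in> parcs H \<and> u < v}. W (x u) (x v))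
        \<partial>completion (\<Pi>\<^sub>M u\<in>pverts H. restrict_space lborel {0..1}))"

datatype 'b target = Graph "'b pair_pre_digraph" | Graphon "real \<Rightarrow> real \<Rightarrow> real"

text \<open>Target graphs are nonempty, so that the normalisation by \<open>v(T)\<close> makes sense.\<close>

fun valid_target :: "'b target \<Rightarrow> bool" where
  "valid_target (Graph T) \<longleftrightarrow> pair_graph T \<and> pverts T \<noteq> {}"
| "valid_target (Graphon W) \<longleftrightarrow> graphon W"

fun hom_density :: "'a::linorder pair_pre_digraph \<Rightarrow> 'b target \<Rightarrow> real" where
  "hom_density H (Graph T) = graph_density H T"
| "hom_density H (Graphon W) = graphon_density H W"

text \<open>
  Every finite graph is isomorphic to one with vertices in \<^typ>\<open>nat\<close>, so \<open>T\<close> ranges over those.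
  Since \<open>0 powr c = 0\<close>, targets with \<open>t(H,T) = 0\<close> impose no condition on \<open>c\<close>, in agreement
  with the description as a supremum over \<open>0 < t(H,T) < 1\<close>.
\<close>

definition domination_exponent ::
    "'a pair_pre_digraph \<Rightarrow> 'b pair_pre_digraph \<Rightarrow> real" where
  "domination_exponent G H =
     (LEAST c. \<forall>T :: nat pair_pre_digraph. pair_graph T \<and> pverts T \<noteq> {} \<longrightarrow>
        graph_density G T \<ge> graph_density H T powr c)"

definition cycle_graph :: "nat \<Rightarrow> nat pair_pre_digraph" where
  "cycle_graph n =
     \<lparr>pverts = {..<n},
      parcs = {(i, j). i < n \<and> j < n \<and> (j = Suc i mod n \<or> i = Suc j mod n)}\<rparr>"

definition even_cycle :: "nat pair_pre_digraph \<Rightarrow> bool" where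
  "even_cycle G \<longleftrightarrow> (\<exists>k\<ge>2. G = cycle_graph (2 * k))"

lemma pair_graph_cycle_graph:
  assumes "n \<ge> 3"
  shows "pair_graph (cycle_graph n)"
proof
  show "finite (parcs (cycle_graph n))"
    by (rule finite_subset[of _ "{..<n} \<times> {..<n}"]) (auto simp: cycle_graph_def)
  show "symmetric (with_proj (cycle_graph n))"
    by (auto simp: symmetric_def cycle_graph_def sym_def)
  have "Suc i mod n \<noteq> i" if "i < n" for i
    using that assms by (cases "Suc i = n") auto
  then show "fst e \<noteq> snd e" if "e \<in> parcs (cycle_graph n)" for e
    using that by (auto simp: cycle_graph_def) metis+
qed (auto simp: cycle_graph_def)

lemma even_cycle_pair_graph: "even_cycle G \<Longrightarrow> pair_graph G"
  by (auto simp: even_cycle_def intro: pair_graph_cycle_graph)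

end

theory Submission
  imports Defs "HOL-Probability.Probability" "HOL-Number_Theory.Number_Theory"
    "HOL-Computational_Algebra.Nth_Powers" "HOL-Real_Asymp.Real_Asymp"
begin

text \<open>
  Take \<open>H = C\<^sub>4\<close> and \<open>G = C\<^bsub>2k\<^esub>\<close> with \<open>k\<close> a power of two. Let \<open>p\<close>, \<open>s\<close>, \<open>u\<close> be the densities of an edge,
  of \<open>C\<^sub>4\<close> and of \<open>C\<^bsub>2k\<^esub>\<close> in a target. Writing cycle densities as Hilbert-Schmidt inner products of
  kernel powers, the Cauchy-Schwarz inequality gives \<open>s\<^bsup>k-1\<^esup> \<le> p\<^bsup>k-2\<^esup> u\<close> and \<open>p\<^bsup>2k\<^esup> \<le> u\<close>, whence
  \<open>u \<ge> s\<^bsup>c\<^esup>\<close> with \<open>c = 2k(k-1)/(3k-2)\<close>. This exponent is optimal: for a prime \<open>m\<close> and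
  \<open>X \<approx> m\<^bsup>1/k\<^esup>\<close>, join \<open>x \<noteq> y\<close> in \<open>{1..<m}\<close> whenever \<open>x y mod m \<le> X\<close>. The edge labels around a closed
  walk of length \<open>2k\<close> have equal alternating products, so by the divisor bound there are only
  \<open>m\<^bsup>2+o(1)\<^esup>\<close> such walks, while there are at least about \<open>m\<^bsup>1+2/k\<^esup>\<close> closed walks of length 4.

  If \<open>ln u / ln s\<close> tends to \<open>c\<close> along a sequence of targets, both inequalities are
  asymptotically tight, so \<open>ln p / ln s\<close> tends to \<open>(k-1)/(3k-2)\<close>. These limits differ for different
  \<open>k\<close>, so each sequence is extremal for at most one \<open>k\<close>, and \<open>N + 1\<close> values of \<open>k\<close> suffice.
\<close>

section \<open>Kernel powers on a probability space\<close>

text \<open>A common setting for both kinds of target: a finite vertex set with normalised counting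
  measure, or the unit interval. Symmetry and bounds are imposed at every point, which spares side
  conditions on the space of \<open>M\<close>.\<close>

locale bounded_kernel = prob_space M for M :: "'a measure" +
  fixes W :: "'a \<Rightarrow> 'a \<Rightarrow> real"
  assumes W_measurable [measurable]: "(\<lambda>(x, y). W x y) \<in> borel_measurable (M \<Otimes>\<^sub>M M)"
    and W_sym: "W x y = W y x"
    and W_nonneg: "0 \<le> W x y"
    and W_le_1: "W x y \<le> 1"
begin

sublocale pair: pair_prob_space M M ..

lemma integral_unit_interval:
  assumes "\<And>x. 0 \<le> f x" "\<And>x. f x \<le> (1::real)"
  shows "0 \<le> (\<integral>x. f x \<partial>M)" "(\<integral>x. f x \<partial>M) \<le> 1"
proof -
  show "0 \<le> (\<integral>x. f x \<partial>M)"
    using assms by (simp add: integral_nonneg_AE)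
  show "(\<integral>x. f x \<partial>M) \<le> 1"
  proof (cases "integrable M f")
    case True
    then have "(\<integral>x. f x \<partial>M) \<le> (\<integral>x. 1 \<partial>M)"
      using assms by (intro integral_mono) auto
    then show ?thesis by (simp add: prob_space)
  qed (simp add: not_integrable_integral_eq)
qed

lemma integrable_unit_interval:
  assumes "f \<in> borel_measurable M" "\<And>x. 0 \<le> f x" "\<And>x. f x \<le> (1::real)"
  shows "integrable M f"
  using assms by (intro integrable_const_bound[of _ 1]) auto

lemma Fubini_bounded:
  fixes f :: "'a \<Rightarrow> 'a \<Rightarrow> real"
  assumes "(\<lambda>(x, y). f x y) \<in> borel_measurable (M \<Otimes>\<^sub>M M)" "\<And>x y. \<bar>f x y\<bar> \<le> B"
  shows "(\<integral>x. (\<integral>y. f x y \<partial>M) \<partial>M) = (\<integral>y. (\<integral>x. f x y \<partial>M) \<partial>M)"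
  using assms by (intro pair.Fubini_integral pair.P.integrable_const_bound[of _ B]) auto

text \<open>Indices are shifted: \<open>kpow n\<close> is the operator power \<open>W\<^bsup>n+1\<^esup>\<close>, and \<open>cycle_moment n\<close> below is the
  density of the cycle with \<open>n + 2\<close> vertices.\<close>

primrec kpow :: "nat \<Rightarrow> 'a \<Rightarrow> 'a \<Rightarrow> real" where
  "kpow 0 x y = W x y"
| "kpow (Suc n) x y = (\<integral>z. kpow n x z * W z y \<partial>M)"

lemma kpow_measurable [measurable]: "(\<lambda>(x, y). kpow n x y) \<in> borel_measurable (M \<Otimes>\<^sub>M M)"
proof (induction n)
  case (Suc n)
  have [measurable]: "(\<lambda>(x, y). kpow n x y) \<in> borel_measurable (M \<Otimes>\<^sub>M M)" by (rule Suc)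
  show ?case unfolding kpow.simps by measurable
qed simp

lemma kpow_nonneg: "0 \<le> kpow n x y" and kpow_le_1: "kpow n x y \<le> 1"
proof -
  have "0 \<le> kpow n x y \<and> kpow n x y \<le> 1" for y
    by (induction n arbitrary: y)
      (auto simp: W_nonneg W_le_1 intro!: integral_unit_interval mult_le_one)
  then show "0 \<le> kpow n x y" "kpow n x y \<le> 1" by auto
qed

lemma abs_kpow_le_1: "\<bar>kpow n x y\<bar> \<le> 1"
  using kpow_nonneg[of n x y] kpow_le_1[of n x y] by simp

lemma abs_W_le_1: "\<bar>W x y\<bar> \<le> 1"
  using W_nonneg[of x y] W_le_1[of x y] by simp

text \<open>The Hilbert-Schmidt inner product, written as an iterated integral so that Fubini
  applies with \<open>x\<close> fixed.\<close>

definition kinner :: "('a \<Rightarrow> 'a \<Rightarrow> real) \<Rightarrow> ('a \<Rightarrow> 'a \<Rightarrow> real) \<Rightarrow> real" where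
  "kinner f g = (\<integral>x. (\<integral>y. f x y * g x y \<partial>M) \<partial>M)"

text \<open>Fubini with \<open>x\<close> fixed moves the last factor \<open>W\<close> of the power
  onto \<open>g\<close>. A general \<open>g\<close> lets kernel powers, walk densities and path
  integrals share this step.\<close>

lemma kinner_kpow_Suc:
  assumes [measurable]: "(\<lambda>(x, y). g x y) \<in> borel_measurable (M \<Otimes>\<^sub>M M)"
    and "\<And>x y. \<bar>g x y\<bar> \<le> B"
  shows "kinner (kpow (Suc n)) g = kinner (kpow n) (\<lambda>x z. \<integral>y. W z y * g x y \<partial>M)"
  unfolding kinner_def
proof (rule Bochner_Integration.integral_cong[OF refl])
  fix x assume [measurable]: "x \<in> space M"
  have "(\<integral>y. kpow (Suc n) x y * g x y \<partial>M) = (\<integral>y. (\<integral>z. kpow n x z * W z y * g x y \<partial>M) \<partial>M)"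
    by simp
  also have "\<dots> = (\<integral>z. (\<integral>y. kpow n x z * W z y * g x y \<partial>M) \<partial>M)"
  proof (rule Fubini_bounded[of _ B])
    fix y z
    have "\<bar>kpow n x z * W z y * g x y\<bar> \<le> 1 * 1 * \<bar>g x y\<bar>"
      unfolding abs_mult by (intro mult_mono) (auto simp: abs_kpow_le_1 abs_W_le_1)
    then show "\<bar>kpow n x z * W z y * g x y\<bar> \<le> B" using assms(2)[of x y] by simp
  qed measurable
  also have "\<dots> = (\<integral>z. kpow n x z * (\<integral>y. W z y * g x y \<partial>M) \<partial>M)"
    by (simp add: mult.assoc)
  finally show "(\<integral>y. kpow (Suc n) x y * g x y \<partial>M)
      = (\<integral>z. kpow n x z * (\<integral>y. W z y * g x y \<partial>M) \<partial>M)" .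
qed

lemma kinner_kpow_shift: "kinner (kpow (Suc m)) (kpow n) = kinner (kpow m) (kpow (Suc n))"
proof -
  have "kinner (kpow (Suc m)) (kpow n) = kinner (kpow m) (\<lambda>x z. \<integral>y. W z y * kpow n x y \<partial>M)"
    by (intro kinner_kpow_Suc[of _ 1] kpow_measurable abs_kpow_le_1)
  also have "(\<lambda>x z. \<integral>y. W z y * kpow n x y \<partial>M) = kpow (Suc n)"
    by (intro ext) (simp add: W_sym mult.commute)
  finally show ?thesis .
qed

definition cycle_moment :: "nat \<Rightarrow> real" where
  "cycle_moment n = kinner (kpow n) W"

text \<open>Factors are moved across one at a time. The shifted indices fit: operator powers
  \<open>m + 1\<close> and \<open>n + 1\<close> close up to a cycle with \<open>m + n + 2\<close>
  vertices.\<close>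

lemma kinner_kpow: "kinner (kpow m) (kpow n) = cycle_moment (m + n)"
proof (induction n arbitrary: m)
  case 0
  have "kpow 0 = W" by (intro ext) simp
  then show ?case by (simp add: cycle_moment_def)
next
  case (Suc n)
  show ?case using Suc[of "Suc m"] by (simp add: kinner_kpow_shift[symmetric] del: kpow.simps)
qed

lemma kinner_pair:
  assumes [measurable]: "(\<lambda>(x, y). f x y) \<in> borel_measurable (M \<Otimes>\<^sub>M M)"
    "(\<lambda>(x, y). g x y) \<in> borel_measurable (M \<Otimes>\<^sub>M M)"
    and "\<And>x y. \<bar>f x y\<bar> \<le> 1" "\<And>x y. \<bar>g x y\<bar> \<le> 1"
  shows "kinner f g = (\<integral>z. f (fst z) (snd z) * g (fst z) (snd z) \<partial>(M \<Otimes>\<^sub>M M))"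
    and "integrable (M \<Otimes>\<^sub>M M) (\<lambda>z. f (fst z) (snd z) * g (fst z) (snd z))"
proof -
  have "\<bar>f x y * g x y\<bar> \<le> 1" for x y
    unfolding abs_mult using assms(3,4) by (intro mult_le_one) auto
  then show int: "integrable (M \<Otimes>\<^sub>M M) (\<lambda>z. f (fst z) (snd z) * g (fst z) (snd z))"
    by (intro pair.P.integrable_const_bound[of _ 1]) auto
  show "kinner f g = (\<integral>z. f (fst z) (snd z) * g (fst z) (snd z) \<partial>(M \<Otimes>\<^sub>M M))"
    unfolding kinner_def using pair.integral_fst'[OF int] by simp
qed

end

section \<open>Cauchy-Schwarz and log-convex sequences\<close>

lemma Cauchy_Schwarz_integral:
  fixes f g :: "'a \<Rightarrow> real"
  assumes "integrable M (\<lambda>x. f x * f x)" "integrable M (\<lambda>x. g x * g x)"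
    and "integrable M (\<lambda>x. f x * g x)"
  shows "(\<integral>x. f x * g x \<partial>M)\<^sup>2 \<le> (\<integral>x. f x * f x \<partial>M) * (\<integral>x. g x * g x \<partial>M)"
proof -
  define a b c where "a = (\<integral>x. f x * f x \<partial>M)" and "b = (\<integral>x. f x * g x \<partial>M)"
    and "c = (\<integral>x. g x * g x \<partial>M)"
  \<comment> \<open>Two parameters avoid division: \<open>u = c\<close> and \<open>t = b\<close>
    turn the form into \<open>c * (a * c - b\<^sup>2)\<close>.\<close>
  have quad: "0 \<le> u\<^sup>2 * a - 2 * u * t * b + t\<^sup>2 * c" for u t
  proof -
    have "0 \<le> (\<integral>x. (u * f x - t * g x)\<^sup>2 \<partial>M)" by simp
    also have "(\<integral>x. (u * f x - t * g x)\<^sup>2 \<partial>M)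
        = (\<integral>x. u\<^sup>2 * (f x * f x) - 2 * u * t * (f x * g x) + t\<^sup>2 * (g x * g x) \<partial>M)"
      by (rule Bochner_Integration.integral_cong) (auto simp: power2_eq_square algebra_simps)
    also have "\<dots> = u\<^sup>2 * a - 2 * u * t * b + t\<^sup>2 * c"
      using assms by (simp add: a_def b_def c_def)
    finally show ?thesis .
  qed
  have "b\<^sup>2 \<le> a * c"
  proof (cases "c = 0")
    case True
    have "0 \<le> a" "0 \<le> c" by (auto simp: a_def c_def)
    have "b = 0"
    proof (rule ccontr)
      assume "b \<noteq> 0"
      \<comment> \<open>As \<open>c = 0\<close>, this choice of \<open>t\<close> gives the form the
        value -1.\<close>
      with quad[of 1 "(a + 1) / (2 * b)"] True show False by (simp add: field_simps)
    qed
    then show ?thesis using True by simp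
  next
    case False
    have "0 \<le> c" by (auto simp: c_def)
    with False have "0 < c" by simp
    have "0 \<le> c * (a * c - b\<^sup>2)"
      using quad[of c b] by (simp add: power2_eq_square algebra_simps)
    then show ?thesis using \<open>0 < c\<close> by (simp add: zero_le_mult_iff)
  qed
  then show ?thesis by (simp add: a_def b_def c_def)
qed

text \<open>Log-convexity makes the quotients \<open>a (Suc n) / a n\<close> nondecreasing, so each
  is at least \<open>a 1 / a 0\<close>, and they multiply up. The fact \<open>ratio\<close> has its
  denominators cleared because terms may vanish.\<close>

lemma log_convex_power_le:
  fixes a :: "nat \<Rightarrow> real"
  assumes nonneg: "\<And>i. 0 \<le> a i" and conv: "\<And>i. (a (Suc i))\<^sup>2 \<le> a i * a (i + 2)"
  shows "a 1 ^ Suc n \<le> a 0 ^ n * a (Suc n)"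
proof -
  have ratio: "a 1 * a n \<le> a 0 * a (Suc n)" for n
  proof (induction n)
    case (Suc n)
    show ?case
    proof (cases "a n = 0")
      case True
      then have "a (Suc n) = 0" using conv[of n] by simp
      then show ?thesis using nonneg by simp
    next
      case False
      then have "0 < a n" using nonneg[of n] by simp
      have "a n * (a 1 * a (Suc n)) \<le> (a 0 * a (Suc n)) * a (Suc n)"
        using mult_right_mono[OF Suc nonneg[of "Suc n"]] by (simp add: mult_ac)
      also have "\<dots> \<le> a 0 * (a n * a (Suc (Suc n)))"
        using mult_left_mono[OF conv[of n] nonneg[of 0]] by (simp add: power2_eq_square mult_ac)
      finally have "a n * (a 1 * a (Suc n)) \<le> a n * (a 0 * a (Suc (Suc n)))"
        by (simp add: mult_ac)
      then show ?thesis using \<open>0 < a n\<close> by simp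
    qed
  qed simp
  show ?thesis
  proof (induction n)
    case (Suc n)
    have "a 1 ^ Suc (Suc n) \<le> a 1 * (a 0 ^ n * a (Suc n))"
      using mult_left_mono[OF Suc nonneg[of 1]] by simp
    also have "\<dots> \<le> a 0 ^ Suc n * a (Suc (Suc n))"
      using mult_left_mono[OF ratio[of "Suc n"], of "a 0 ^ n"] nonneg by (simp add: mult_ac)
    finally show ?case .
  qed simp
qed

section \<open>Inequalities between cycle moments, edge density and walk densities\<close>

context bounded_kernel
begin

lemma kinner_Cauchy_Schwarz:
  assumes "(\<lambda>(x, y). f x y) \<in> borel_measurable (M \<Otimes>\<^sub>M M)"
    "(\<lambda>(x, y). g x y) \<in> borel_measurable (M \<Otimes>\<^sub>M M)"
    and "\<And>x y. \<bar>f x y\<bar> \<le> 1" "\<And>x y. \<bar>g x y\<bar> \<le> 1"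
  shows "(kinner f g)\<^sup>2 \<le> kinner f f * kinner g g"
  unfolding kinner_pair(1)[OF assms] kinner_pair(1)[OF assms(1,1,3,3)]
    kinner_pair(1)[OF assms(2,2,4,4)]
  by (intro Cauchy_Schwarz_integral kinner_pair(2) assms)

text \<open>Cauchy-Schwarz for \<open>kpow i\<close> and \<open>kpow (i + 2)\<close>: the index of
  their inner product lies halfway between those of their squared norms.\<close>

lemma cycle_moment_log_convex:
  "(cycle_moment (2 * Suc i))\<^sup>2 \<le> cycle_moment (2 * i) * cycle_moment (2 * (i + 2))"
proof -
  have "i + (i + 2) = 2 * Suc i" "i + i = 2 * i" "(i + 2) + (i + 2) = 2 * (i + 2)" by auto
  then show ?thesis
    using kinner_Cauchy_Schwarz[OF kpow_measurable kpow_measurable abs_kpow_le_1 abs_kpow_le_1,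
        of i "i + 2"]
    unfolding kinner_kpow by metis
qed

lemma cycle_moment_nonneg: "0 \<le> cycle_moment n"
  unfolding cycle_moment_def kinner_def
  by (intro Bochner_Integration.integral_nonneg mult_nonneg_nonneg kpow_nonneg W_nonneg)

lemma cycle_moment_le_1: "cycle_moment n \<le> 1"
  unfolding cycle_moment_def kinner_def
  by (intro integral_unit_interval mult_le_one mult_nonneg_nonneg kpow_nonneg W_nonneg kpow_le_1 W_le_1)

definition edge_density :: real where
  "edge_density = (\<integral>x. (\<integral>y. W x y \<partial>M) \<partial>M)"

lemma edge_density_nonneg: "0 \<le> edge_density"
  unfolding edge_density_def by (intro integral_unit_interval W_nonneg W_le_1)

text \<open>The degenerate cycle on two vertices contributes the integral of the square of
  \<open>W\<close>, and squaring does not increase values in the unit interval.\<close>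

lemma cycle_moment_0_le: "cycle_moment 0 \<le> edge_density"
  unfolding cycle_moment_def kinner_def edge_density_def kpow.simps
proof (intro integral_mono)
  show "integrable M (\<lambda>x. \<integral>y. W x y * W x y \<partial>M)" "integrable M (\<lambda>x. \<integral>y. W x y \<partial>M)"
    by (intro integrable_unit_interval integral_unit_interval mult_nonneg_nonneg mult_le_one
        W_nonneg W_le_1; measurable)+
next
  fix x y assume [measurable]: "x \<in> space M"
  show "integrable M (\<lambda>y. W x y * W x y)" "integrable M (\<lambda>y. W x y)"
    by (intro integrable_unit_interval mult_nonneg_nonneg mult_le_one W_nonneg W_le_1; measurable)+
  show "W x y * W x y \<le> W x y"
    using W_nonneg W_le_1 by (simp add: mult_left_le)
qed

text \<open>The density of walks with \<open>n\<close> edges starting at \<open>x\<close>, that is,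
  the integral operator of \<open>W\<close> applied \<open>n\<close> times to the constant
  1.\<close>

primrec wdeg :: "nat \<Rightarrow> 'a \<Rightarrow> real" where
  "wdeg 0 x = 1"
| "wdeg (Suc n) x = (\<integral>y. W x y * wdeg n y \<partial>M)"

lemma wdeg_measurable [measurable]: "wdeg n \<in> borel_measurable M"
proof (induction n)
  case (Suc n)
  have [measurable]: "wdeg n \<in> borel_measurable M" by (rule Suc)
  have "(\<lambda>x. wdeg (Suc n) x) \<in> borel_measurable M" unfolding wdeg.simps by measurable
  then show ?case by simp
next
  case 0
  have "(\<lambda>x. wdeg 0 x) \<in> borel_measurable M" by simp
  then show ?case by simp
qed

lemma wdeg_nonneg: "0 \<le> wdeg n x" and wdeg_le_1: "wdeg n x \<le> 1"
proof -
  have "0 \<le> wdeg n x \<and> wdeg n x \<le> 1" for x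
    by (induction n arbitrary: x)
      (auto simp: W_nonneg W_le_1 intro!: integral_unit_interval mult_le_one)
  then show "0 \<le> wdeg n x" "wdeg n x \<le> 1" by auto
qed

text \<open>Self-adjointness of the integral operator with the symmetric kernel
  \<open>W\<close>.\<close>

lemma wdeg_shift: "(\<integral>x. wdeg (Suc m) x * wdeg n x \<partial>M) = (\<integral>x. wdeg m x * wdeg (Suc n) x \<partial>M)"
proof -
  have "(\<integral>x. wdeg (Suc m) x * wdeg n x \<partial>M) = (\<integral>x. (\<integral>y. W x y * wdeg m y * wdeg n x \<partial>M) \<partial>M)"
    by simp
  also have "\<dots> = (\<integral>y. (\<integral>x. W x y * wdeg m y * wdeg n x \<partial>M) \<partial>M)"
  proof (rule Fubini_bounded[of _ 1])
    show "\<bar>W x y * wdeg m y * wdeg n x\<bar> \<le> 1" for x y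
      by (simp add: W_nonneg W_le_1 wdeg_nonneg wdeg_le_1 mult_le_one)
  qed measurable
  also have "\<dots> = (\<integral>y. (\<integral>x. wdeg m y * (W y x * wdeg n x) \<partial>M) \<partial>M)"
    by (subst W_sym) (simp only: mult_ac)
  finally show ?thesis by simp
qed

definition walk_density :: "nat \<Rightarrow> real" where
  "walk_density n = (\<integral>x. wdeg n x \<partial>M)"

lemma walk_density_add: "(\<integral>x. wdeg m x * wdeg n x \<partial>M) = walk_density (m + n)"
proof (induction n arbitrary: m)
  case 0
  then show ?case by (simp add: walk_density_def)
next
  case (Suc n)
  show ?case using Suc[of "Suc m"] by (simp add: wdeg_shift[symmetric] del: wdeg.simps)
qed

text \<open>Cauchy-Schwarz for \<open>wdeg n\<close> against the constant 1.\<close>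

lemma walk_density_double: "(walk_density n)\<^sup>2 \<le> walk_density (2 * n)"
proof -
  have "integrable M (\<lambda>x. wdeg n x * wdeg m x)" for m
    by (intro integrable_unit_interval) (auto simp: wdeg_nonneg wdeg_le_1 mult_le_one)
  from this[of n] this[of 0] have "(\<integral>x. wdeg n x * 1 \<partial>M)\<^sup>2
      \<le> (\<integral>x. wdeg n x * wdeg n x \<partial>M) * (\<integral>x. 1 * 1 \<partial>M)"
    by (intro Cauchy_Schwarz_integral) simp_all
  then show ?thesis
    unfolding walk_density_add mult_2 by (simp add: walk_density_def prob_space)
qed

text \<open>Iterated doubling, starting from walks with one edge. The restriction to powers of two
  originates here.\<close>

lemma walk_density_power_of_2: "edge_density ^ (2 ^ j) \<le> walk_density (2 ^ j)"
proof (induction j)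
  case 0
  then show ?case by (simp add: walk_density_def edge_density_def)
next
  case (Suc j)
  have "edge_density ^ (2 ^ Suc j) = (edge_density ^ (2 ^ j))\<^sup>2"
    by (simp add: power_mult[symmetric] mult.commute)
  also have "\<dots> \<le> (walk_density (2 ^ j))\<^sup>2"
    using Suc by (intro power_mono) (auto simp: edge_density_nonneg)
  also have "\<dots> \<le> walk_density (2 ^ Suc j)"
    using walk_density_double[of "2 ^ j"] by simp
  finally show ?case .
qed

text \<open>The factors of the power pass one by one to the second kernel, which stays independent
  of its first argument and becomes a \<open>wdeg\<close> of higher index.\<close>

lemma kinner_kpow_wdeg: "kinner (kpow n) (\<lambda>x y. wdeg m y) = walk_density (Suc (n + m))"
proof (induction n arbitrary: m)
  case 0
  then show ?case by (simp add: kinner_def walk_density_def)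
next
  case (Suc n)
  have "kinner (kpow (Suc n)) (\<lambda>x y. wdeg m y)
      = kinner (kpow n) (\<lambda>x z. \<integral>y. W z y * wdeg m y \<partial>M)"
    by (rule kinner_kpow_Suc[of _ 1]) (auto simp: wdeg_nonneg wdeg_le_1)
  also have "\<dots> = walk_density (Suc (Suc n + m))"
    using Suc[of "Suc m"] by simp
  finally show ?case .
qed

text \<open>Cauchy-Schwarz against the constant kernel 1, written as \<open>wdeg 0\<close>. The
  squared norm of \<open>kpow n\<close> glues two paths at both ends into a cycle.\<close>

lemma walk_density_le_cycle_moment: "(walk_density (Suc n))\<^sup>2 \<le> cycle_moment (2 * n)"
proof -
  have "(kinner (kpow n) (\<lambda>x y. wdeg 0 y))\<^sup>2
      \<le> kinner (kpow n) (kpow n) * kinner (\<lambda>x y. wdeg 0 y) (\<lambda>x y. wdeg 0 y)"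
    by (rule kinner_Cauchy_Schwarz) (auto simp: abs_kpow_le_1)
  also have "kinner (\<lambda>x y. wdeg 0 y) (\<lambda>x y. wdeg 0 y) = 1"
    by (simp add: kinner_def prob_space)
  finally show ?thesis unfolding kinner_kpow_wdeg kinner_kpow mult_2 by simp
qed

lemma edge_density_power_le_cycle_moment:
  assumes "k = 2 ^ j"
  shows "edge_density ^ (2 * k) \<le> cycle_moment (2 * k - 2)"
proof -
  from assms obtain n where n: "k = Suc n" by (metis gr0_implies_Suc zero_less_numeral zero_less_power)
  have "edge_density ^ (2 * k) = (edge_density ^ k)\<^sup>2"
    by (simp add: power_mult[symmetric] mult.commute)
  also have "\<dots> \<le> (walk_density k)\<^sup>2"
    using walk_density_power_of_2[of j] assms by (intro power_mono) (auto simp: edge_density_nonneg)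
  also have "\<dots> \<le> cycle_moment (2 * k - 2)"
    using walk_density_le_cycle_moment[of n] n by simp
  finally show ?thesis .
qed

text \<open>Log-convexity of the even moments, with moment 0 replaced by the edge density. For
  \<open>n = k - 2\<close> the last factor belongs to the cycle with \<open>2 * k\<close>
  vertices.\<close>

lemma cycle_moment_2_power_le:
  "cycle_moment 2 ^ Suc n \<le> edge_density ^ n * cycle_moment (2 * Suc n)"
proof -
  have "cycle_moment 2 ^ Suc n \<le> cycle_moment 0 ^ n * cycle_moment (2 * Suc n)"
    using log_convex_power_le[of "\<lambda>i. cycle_moment (2 * i)" n, OF cycle_moment_nonneg
      cycle_moment_log_convex] by simp
  also have "\<dots> \<le> edge_density ^ n * cycle_moment (2 * Suc n)"
    by (intro mult_right_mono power_mono cycle_moment_0_le cycle_moment_nonneg)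
  finally show ?thesis .
qed

end

section \<open>Densities of cycles in graphs\<close>

text \<open>The integrand of \<open>graphon_density\<close> over an arbitrary \<open>M\<close> and
  without completion, so that product measure theory applies directly. Graph and graphon densities
  are both reduced to this form.\<close>

definition kernel_density ::
    "'a measure \<Rightarrow> ('a \<Rightarrow> 'a \<Rightarrow> real) \<Rightarrow> 'v::linorder pair_pre_digraph \<Rightarrow> real" where
  "kernel_density M W H =
     (\<integral>x. (\<Prod>(u, v)\<in>{(u, v). (u, v) \<in> parcs H \<and> u < v}. W (x u) (x v))
        \<partial>(\<Pi>\<^sub>M u\<in>pverts H. M))"

lemma cycle_graph_increasing_arcs:
  assumes "n \<ge> 1"
  shows "{(u, v). (u, v) \<in> parcs (cycle_graph (n + 2)) \<and> u < v}
    = insert (0, Suc n) ((\<lambda>i. (i, Suc i)) ` {..<Suc n})"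
proof (intro equalityI subsetI)
  fix e assume "e \<in> {(u, v). (u, v) \<in> parcs (cycle_graph (n + 2)) \<and> u < v}"
  then show "e \<in> insert (0, Suc n) ((\<lambda>i. (i, Suc i)) ` {..<Suc n})"
    by (auto simp: cycle_graph_def mod_Suc split: if_splits)
next
  fix e assume "e \<in> insert (0, Suc n) ((\<lambda>i. (i, Suc i)) ` {..<Suc n})"
  then show "e \<in> {(u, v). (u, v) \<in> parcs (cycle_graph (n + 2)) \<and> u < v}"
    using assms by (auto simp: cycle_graph_def)
qed

lemma prod_cycle_graph_arcs:
  assumes "n \<ge> 1"
  shows "(\<Prod>(u, v)\<in>{(u, v). (u, v) \<in> parcs (cycle_graph (n + 2)) \<and> u < v}. f u v)
    = (\<Prod>i<Suc n. f i (Suc i)) * (f 0 (Suc n) :: real)"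
proof -
  \<comment> \<open>Because \<open>n \<ge> 1\<close>, the closing edge differs from the path edge
    \<open>(0, 1)\<close>, so its factor is counted separately.\<close>
  have "(0, Suc n) \<notin> (\<lambda>i. (i, Suc i)) ` {..<Suc n}" using assms by auto
  then show ?thesis
    unfolding cycle_graph_increasing_arcs[OF assms]
    by (simp add: prod.reindex inj_on_def del: prod.lessThan_Suc)
qed

context bounded_kernel
begin

text \<open>The closing edge is generalised to an arbitrary bounded \<open>g\<close>. The induction
  integrates out the last vertex of the path and absorbs it into \<open>g\<close>; taking
  \<open>g = W\<close> closes the cycle.\<close>

lemma path_integral:
  assumes [measurable]: "(\<lambda>(x, y). g x y) \<in> borel_measurable (M \<Otimes>\<^sub>M M)"
    and "\<And>x y. \<bar>g x y\<bar> \<le> 1"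
  shows "(\<integral>x. (\<Prod>i<Suc n. W (x i) (x (Suc i))) * g (x 0) (x (Suc n)) \<partial>(\<Pi>\<^sub>M i\<in>{..<n + 2}. M))
    = kinner (kpow n) g"
  using assms
proof (induction n arbitrary: g)
  interpret PS: product_prob_space "\<lambda>_::nat. M" ..
  have integrable_path: "integrable (\<Pi>\<^sub>M i\<in>{..<n + 2}. M)
      (\<lambda>x. (\<Prod>i<Suc n. W (x i) (x (Suc i))) * g (x 0) (x (Suc n)))"
    if [measurable]: "(\<lambda>(x, y). g x y) \<in> borel_measurable (M \<Otimes>\<^sub>M M)"
      and "\<And>x y. \<bar>g x y\<bar> \<le> 1" for g :: "'a \<Rightarrow> 'a \<Rightarrow> real" and n
  proof -
    interpret P: prob_space "\<Pi>\<^sub>M i\<in>{..<n + 2}. M" by (intro prob_space_PiM prob_space_axioms)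
    have "\<bar>(\<Prod>i<Suc n. W (x i) (x (Suc i))) * g (x 0) (x (Suc n))\<bar> \<le> 1" for x
      unfolding abs_mult abs_prod
      by (intro mult_le_one prod_le_1 prod_nonneg) (auto simp: abs_W_le_1 that)
    moreover have "(\<lambda>x. (\<Prod>i<Suc n. W (x i) (x (Suc i))) * g (x 0) (x (Suc n)))
        \<in> borel_measurable (\<Pi>\<^sub>M i\<in>{..<n + 2}. M)"
      by (intro borel_measurable_times borel_measurable_prod) (measurable; simp)+
    ultimately show ?thesis
      by (intro P.integrable_const_bound[of _ 1]) auto
  qed
  {
    case (0 g)
    note 0(1)[measurable]
    have two: "{..<0 + 2} = insert 1 {0::nat}" by auto
    have "(\<integral>x. (\<Prod>i<Suc 0. W (x i) (x (Suc i))) * g (x 0) (x (Suc 0)) \<partial>(\<Pi>\<^sub>M i\<in>{..<0 + 2}. M))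
      = (\<integral>x. (\<integral>y. (\<Prod>i<Suc 0. W ((x(1 := y)) i) ((x(1 := y)) (Suc i)))
          * g ((x(1 := y)) 0) ((x(1 := y)) (Suc 0)) \<partial>M) \<partial>(\<Pi>\<^sub>M i\<in>{0::nat}. M))"
      unfolding two
      by (rule PS.product_integral_insert[OF _ _ integrable_path[OF 0, of 0, unfolded two]]) auto
    also have "\<dots> = (\<integral>x. (\<integral>y. W (x 0) y * g (x 0) y \<partial>M) \<partial>(\<Pi>\<^sub>M i\<in>{0::nat}. M))"
      by simp
    also have "\<dots> = (\<integral>x. (\<integral>y. W x y * g x y \<partial>M) \<partial>M)"
      by (rule PS.product_integral_singleton[of "\<lambda>x. \<integral>y. W x y * g x y \<partial>M"]) measurable
    finally show ?case by (simp add: kinner_def)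
  next
    case (Suc n g)
    note Suc.prems(1)[measurable]
    have step: "\<bar>\<integral>y. W z y * g x y \<partial>M\<bar> \<le> 1" for x z
    proof -
      have "\<bar>\<integral>y. W z y * g x y \<partial>M\<bar> \<le> (\<integral>y. \<bar>W z y * g x y\<bar> \<partial>M)"
        by (rule integral_abs_bound)
      also have "\<dots> \<le> 1"
        by (intro integral_unit_interval) (auto simp: abs_mult abs_W_le_1 Suc.prems intro!: mult_le_one)
      finally show ?thesis .
    qed
    have ins: "{..<Suc n + 2} = insert (n + 2) {..<n + 2}" by auto
    have "(\<integral>x. (\<Prod>i<Suc (Suc n). W (x i) (x (Suc i))) * g (x 0) (x (Suc (Suc n)))
          \<partial>(\<Pi>\<^sub>M i\<in>{..<Suc n + 2}. M))
      = (\<integral>x. (\<integral>y. (\<Prod>i<Suc (Suc n). W ((x(n + 2 := y)) i) ((x(n + 2 := y)) (Suc i)))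
           * g ((x(n + 2 := y)) 0) ((x(n + 2 := y)) (Suc (Suc n))) \<partial>M) \<partial>(\<Pi>\<^sub>M i\<in>{..<n + 2}. M))"
      unfolding ins
      by (rule PS.product_integral_insert[OF _ _ integrable_path[OF Suc.prems, of "Suc n", unfolded ins]])
        auto
    \<comment> \<open>The new vertex \<open>n + 2\<close> occurs only in the last path edge and in
      \<open>g\<close>, so the other factors leave the inner integral.\<close>
    also have "\<dots> = (\<integral>x. (\<Prod>i<Suc n. W (x i) (x (Suc i)))
          * (\<integral>y. W (x (Suc n)) y * g (x 0) y \<partial>M) \<partial>(\<Pi>\<^sub>M i\<in>{..<n + 2}. M))"
    proof (rule Bochner_Integration.integral_cong[OF refl])
      fix x
      have "(\<Prod>i<Suc n. W ((x(n + 2 := y)) i) ((x(n + 2 := y)) (Suc i)))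
          = (\<Prod>i<Suc n. W (x i) (x (Suc i)))" for y
        by (intro prod.cong) auto
      then show "(\<integral>y. (\<Prod>i<Suc (Suc n). W ((x(n + 2 := y)) i) ((x(n + 2 := y)) (Suc i)))
           * g ((x(n + 2 := y)) 0) ((x(n + 2 := y)) (Suc (Suc n))) \<partial>M)
        = (\<Prod>i<Suc n. W (x i) (x (Suc i))) * (\<integral>y. W (x (Suc n)) y * g (x 0) y \<partial>M)"
        by (subst prod.lessThan_Suc) (simp add: mult.assoc del: prod.lessThan_Suc)
    qed
    also have "\<dots> = kinner (kpow n) (\<lambda>x z. \<integral>y. W z y * g x y \<partial>M)"
      by (rule Suc.IH) (measurable, rule step)
    also have "\<dots> = kinner (kpow (Suc n)) g"
      by (rule kinner_kpow_Suc[symmetric]) (use Suc.prems in auto)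
    finally show ?case .
  }
qed

lemma kernel_density_cycle_graph:
  assumes "n \<ge> 1"
  shows "kernel_density M W (cycle_graph (n + 2)) = cycle_moment n"
  unfolding kernel_density_def prod_cycle_graph_arcs[OF assms] cycle_moment_def
  using path_integral[OF W_measurable abs_W_le_1, of n] by (simp add: cycle_graph_def)

end

section \<open>Finite graphs as kernels\<close>

lemma bounded_kernel_adjacency:
  assumes "pair_graph T" "pverts T \<noteq> {}"
  shows "bounded_kernel (uniform_count_measure (pverts T)) (\<lambda>x y. of_bool ((x, y) \<in> parcs T))"
proof -
  interpret pair_graph T by fact
  interpret prob_space "uniform_count_measure (pverts T)"
    using assms by (intro prob_space_uniform_count_measure) auto
  show ?thesis
  proof
    \<comment> \<open>On a finite vertex set the product sigma-algebra is the full power set, so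
      measurability is automatic.\<close>
    have "sets (uniform_count_measure (pverts T) \<Otimes>\<^sub>M uniform_count_measure (pverts T))
        = Pow (pverts T \<times> pverts T)"
      by (intro sets_pair_countable) (auto simp: sets_uniform_count_measure countable_finite)
    then show "(\<lambda>(x, y). of_bool ((x, y) \<in> parcs T))
      \<in> borel_measurable (uniform_count_measure (pverts T) \<Otimes>\<^sub>M uniform_count_measure (pverts T))"
      by (auto simp: measurable_def space_pair_measure space_uniform_count_measure)
    show "of_bool ((x, y) \<in> parcs T) = of_bool ((y, x) \<in> parcs T)" for x y
      using arcs_symmetric by auto
  qed auto
qed

text \<open>A finite product of uniform measures gives every function the same mass, which turns the
  integral into an average.\<close>

lemma integral_PiM_uniform_count_measure:
  fixes f :: "('v \<Rightarrow> 'a) \<Rightarrow> real"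
  assumes "finite I" "finite A" "A \<noteq> {}"
  shows "(\<integral>x. f x \<partial>(\<Pi>\<^sub>M i\<in>I. uniform_count_measure A)) = (\<Sum>x\<in>I \<rightarrow>\<^sub>E A. f x) / real (card A) ^ card I"
proof -
  let ?P = "\<Pi>\<^sub>M i\<in>I. uniform_count_measure A"
  interpret prob_space "uniform_count_measure A"
    using assms by (intro prob_space_uniform_count_measure) auto
  interpret PS: product_prob_space "\<lambda>_::'v. uniform_count_measure A" ..
  have fin: "finite (I \<rightarrow>\<^sub>E A)" using assms by (intro finite_PiE) auto
  have space: "space ?P = I \<rightarrow>\<^sub>E A" by (simp add: space_PiM space_uniform_count_measure)
  \<comment> \<open>A singleton is a box, so its mass is a product of the masses of its
    coordinates.\<close>
  have single: "{x} = (\<Pi>\<^sub>E i\<in>I. {x i})" if "x \<in> I \<rightarrow>\<^sub>E A" for x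
    using that by (auto simp: PiE_iff extensional_def fun_eq_iff) metis
  have sets: "{x} \<in> sets ?P" if "x \<in> I \<rightarrow>\<^sub>E A" for x
    using that assms by (subst single) (auto intro!: sets_PiM_I_finite simp: sets_uniform_count_measure)
  have emeasure: "emeasure ?P {x} = ennreal (1 / real (card A) ^ card I)" if "x \<in> I \<rightarrow>\<^sub>E A" for x
  proof -
    have "emeasure ?P {x} = (\<Prod>i\<in>I. emeasure (uniform_count_measure A) {x i})"
      using that assms
      by (subst single) (auto intro!: PS.emeasure_PiM simp: sets_uniform_count_measure)
    also have "\<dots> = (\<Prod>i\<in>I. ennreal (1 / real (card A)))"
      using PiE_mem[OF that] assms by (intro prod.cong) (auto simp: emeasure_uniform_count_measure)
    also have "\<dots> = ennreal (1 / real (card A) ^ card I)"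
      by (simp add: ennreal_power power_divide)
    finally show ?thesis .
  qed
  have "(\<integral>x. f x \<partial>?P) = (\<integral>x. (\<Sum>e\<in>I \<rightarrow>\<^sub>E A. indicator {e} x * f e) \<partial>?P)"
    using fin by (intro Bochner_Integration.integral_cong)
      (auto simp: space indicator_def sum.delta if_distrib[of "\<lambda>x. x * _"] cong: if_cong)
  also have "\<dots> = (\<Sum>e\<in>I \<rightarrow>\<^sub>E A. measure ?P {e} * f e)"
    by (subst Bochner_Integration.integral_sum) (auto simp: sets emeasure)
  also have "\<dots> = (\<Sum>x\<in>I \<rightarrow>\<^sub>E A. f x) / real (card A) ^ card I"
    unfolding sum_divide_distrib by (intro sum.cong) (auto simp: measure_def emeasure)
  finally show ?thesis .
qed

text \<open>The product of adjacency indicators over increasing arcs is the indicator of a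
  homomorphism: symmetry of both graphs covers the decreasing arcs.\<close>

lemma graph_density_eq_kernel_density:
  fixes H :: "'v::linorder pair_pre_digraph"
  assumes "pair_graph H" "pair_graph T" "pverts T \<noteq> {}"
  shows "graph_density H T
    = kernel_density (uniform_count_measure (pverts T)) (\<lambda>x y. of_bool ((x, y) \<in> parcs T)) H"
proof -
  interpret H: pair_graph H by fact
  interpret T: pair_graph T by fact
  let ?E = "{(u, v). (u, v) \<in> parcs H \<and> u < v}"
  have finE: "finite ?E" by (rule finite_subset[of _ "parcs H"]) auto
  have hom: "(\<forall>u v. (u, v) \<in> parcs H \<longrightarrow> (f u, f v) \<in> parcs T) \<longleftrightarrow> (\<forall>(u, v)\<in>?E. (f u, f v) \<in> parcs T)" for f
  proof (intro iffI allI impI)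
    fix u v assume *: "\<forall>(u, v)\<in>?E. (f u, f v) \<in> parcs T" and uv: "(u, v) \<in> parcs H"
    have "u \<noteq> v" using H.no_loops[OF uv] by simp
    then consider "u < v" | "v < u" by force
    then show "(f u, f v) \<in> parcs T"
    proof cases
      case 2
      have "(v, u) \<in> parcs H" using uv H.arcs_symmetric by auto
      then have "(f v, f u) \<in> parcs T" using 2 * by auto
      then show ?thesis using T.arcs_symmetric by auto
    qed (use * uv in auto)
  qed auto
  have "(\<Prod>(u, v)\<in>?E. of_bool ((f u, f v) \<in> parcs T))
      = (of_bool (\<forall>u v. (u, v) \<in> parcs H \<longrightarrow> (f u, f v) \<in> parcs T) :: real)" for f
    unfolding hom using finE by (auto simp: case_prod_unfold intro!: prod.neutral prod_zero)
  then have "kernel_density (uniform_count_measure (pverts T)) (\<lambda>x y. of_bool ((x, y) \<in> parcs T)) H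
    = (\<Sum>f\<in>pverts H \<rightarrow>\<^sub>E pverts T. of_bool (\<forall>u v. (u, v) \<in> parcs H \<longrightarrow> (f u, f v) \<in> parcs T))
       / real (card (pverts T)) ^ card (pverts H)"
    unfolding kernel_density_def using assms by (subst integral_PiM_uniform_count_measure) auto
  also have "\<dots> = graph_density H T"
    unfolding graph_density_def hom_count_def
    by (simp add: finite_PiE Int_def of_bool_def sum.If_cases)
  finally show ?thesis ..
qed

section \<open>Graphons\<close>

text \<open>Preimages under \<open>f\<close> and \<open>g\<close> differ only inside a null set,
  which the completion makes measurable. This serves graphons, whose integrands are not assumed
  Borel.\<close>

lemma measurable_completion_AE_eq:
  fixes f g :: "'a \<Rightarrow> real"
  assumes [measurable]: "g \<in> borel_measurable M" and ae: "AE x in M. f x = g x"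
  shows "f \<in> borel_measurable (completion M)"
proof (rule measurableI)
  fix A :: "real set" assume A: "A \<in> sets borel"
  show "f -` A \<inter> space (completion M) \<in> sets (completion M)"
  proof (rule completion.in_sets_AE)
    show "g -` A \<inter> space M \<in> sets (completion M)"
      using A by (intro sets_completionI_sets measurable_sets[OF assms(1)])
    show "AE x in completion M. x \<in> g -` A \<inter> space M \<longleftrightarrow> x \<in> f -` A \<inter> space (completion M)"
      using AE_completion[OF ae] by eventually_elim auto
  qed auto
qed auto

lemma integral_completion_AE_eq:
  fixes f g :: "'a \<Rightarrow> real"
  assumes "g \<in> borel_measurable M" "AE x in M. f x = g x"
  shows "integral\<^sup>L (completion M) f = integral\<^sup>L M g"
proof -
  have "integral\<^sup>L (completion M) f = integral\<^sup>L (completion M) g"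
    using assms
    by (intro integral_cong_AE measurable_completion_AE_eq[OF assms] measurable_completion AE_completion)
  then show ?thesis by (simp add: integral_completion assms)
qed

text \<open>It suffices to compare the two measures on rectangles. Null sets of pairs thus pull back
  to null sets of vertex assignments, one edge at a time.\<close>

lemma (in prob_space) distr_PiM_two_components:
  assumes "u \<in> I" "v \<in> I" "u \<noteq> v"
  shows "distr (\<Pi>\<^sub>M i\<in>I. M) (M \<Otimes>\<^sub>M M) (\<lambda>x. (x u, x v)) = M \<Otimes>\<^sub>M M"
proof -
  interpret PS: product_prob_space "\<lambda>_. M" I ..
  have [measurable]: "(\<lambda>x. (x u, x v)) \<in> (\<Pi>\<^sub>M i\<in>I. M) \<rightarrow>\<^sub>M M \<Otimes>\<^sub>M M"
    using assms by measurable
  show ?thesis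
  proof (rule pair_measure_eqI[symmetric])
    fix A B assume [measurable]: "A \<in> sets M" "B \<in> sets M"
    have "(\<lambda>x. (x u, x v)) -` (A \<times> B) \<inter> space (\<Pi>\<^sub>M i\<in>I. M)
      = {x \<in> space (\<Pi>\<^sub>M i\<in>I. M). \<forall>i\<in>{u, v}. x i \<in> (if i = u then A else B)}"
      using assms by auto
    then show "emeasure M A * emeasure M B
        = emeasure (distr (\<Pi>\<^sub>M i\<in>I. M) (M \<Otimes>\<^sub>M M) (\<lambda>x. (x u, x v))) (A \<times> B)"
      using assms PS.emeasure_PiM_Collect[of "{u, v}" "\<lambda>i. if i = u then A else B"]
      by (simp add: emeasure_distr)
  qed (auto intro: sigma_finite_measure_axioms)
qed

lemma prob_space_unit_interval: "prob_space (restrict_space lborel {0..1::real})"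
  by (rule prob_space_restrict_space) auto

text \<open>A Lebesgue measurable function agrees almost everywhere with a Borel one. Clipping and
  symmetrising the latter restores the pointwise kernel conditions.\<close>

lemma graphon_Borel_version:
  assumes "graphon W"
  obtains W' where "bounded_kernel (restrict_space lborel {0..1}) W'"
    and "AE z in restrict_space lborel {0..1} \<Otimes>\<^sub>M restrict_space lborel {0..1}.
           W (fst z) (snd z) = W' (fst z) (snd z)"
proof -
  let ?Q = "{0..1} \<times> {0..1} :: (real \<times> real) set"
  let ?M = "restrict_space lborel {0..1::real}"
  interpret prob_space ?M by (rule prob_space_unit_interval)
  interpret pair: pair_prob_space ?M ?M ..
  \<comment> \<open>Extension by zero allows the Borel version to be taken on the whole
    plane.\<close>
  define g where "g z = (if z \<in> ?Q then W (fst z) (snd z) else 0)" for z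
  have "(\<lambda>(x, y). W x y) \<in> borel_measurable (lebesgue_on ?Q)"
    using assms by (simp add: graphon_def)
  moreover have "?Q \<in> sets lebesgue"
    by (intro sets_completionI_sets) (simp add: borel_closed closed_Times)
  ultimately have "(\<lambda>z. if z \<in> ?Q then (\<lambda>(x, y). W x y) z else 0) \<in> borel_measurable lebesgue"
    by (rule borel_measurable_if_I)
  then have "g \<in> borel_measurable lebesgue"
    unfolding g_def[abs_def] case_prod_unfold .
  then obtain g' where g': "g' \<in> borel_measurable lborel" and ae: "AE z in lborel. g z = g' z"
    using completion_ex_borel_measurable_real[of g lborel] by auto
  have [measurable]: "g' \<in> borel_measurable (borel \<Otimes>\<^sub>M borel)"
    using g' by (simp add: borel_prod)
  from ae obtain N where N: "{z. g z \<noteq> g' z} \<subseteq> N" "N \<in> null_sets lborel"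
    by (auto elim!: AE_E simp: null_sets_def)
  then have [measurable]: "N \<in> sets (borel \<Otimes>\<^sub>M borel)"
    unfolding borel_prod by (auto simp: null_sets_def)
  then have "- N \<in> sets (borel \<Otimes>\<^sub>M borel)"
    unfolding borel_prod by (rule borel_comp)
  have "AE z in lborel \<Otimes>\<^sub>M lborel. z \<notin> N"
    using N by (simp add: lborel_prod AE_not_in)
  then have ae1: "AE x in lborel. AE y in lborel. (x, y) \<notin> N"
    by (rule lborel_pair.AE_pair)
  \<comment> \<open>The exchanged order is what controls the reflected pair \<open>(y, x)\<close> in
    the symmetrisation.\<close>
  then have ae2: "AE y in lborel. AE x in lborel. (x, y) \<notin> N"
    using \<open>- N \<in> sets _\<close>
    by (subst (asm) lborel_pair.AE_commute) (auto simp: space_pair_measure Collect_neg_eq)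
  have restrict: "AE x in ?M. AE y in ?M. P x y" if "AE x in lborel. AE y in lborel. P x y"
    for P :: "real \<Rightarrow> real \<Rightarrow> bool"
    using that by (auto simp: AE_restrict_space_iff)
  \<comment> \<open>Where \<open>g'\<close> agrees with \<open>W\<close> at both
    \<open>(x, y)\<close> and \<open>(y, x)\<close>, neither clipping nor averaging changes the
    value.\<close>
  define V where "V x y = max 0 (min 1 (g' (x, y)))" for x y
  define W' where "W' x y = (V x y + V y x) / 2" for x y
  have M_borel [measurable]: "(\<lambda>x. x) \<in> ?M \<rightarrow>\<^sub>M borel"
    by (intro measurable_restrict_space1) simp
  have pairs [measurable]: "(\<lambda>z. (fst z, snd z)) \<in> ?M \<Otimes>\<^sub>M ?M \<rightarrow>\<^sub>M borel \<Otimes>\<^sub>M borel"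
    "(\<lambda>z. (snd z, fst z)) \<in> ?M \<Otimes>\<^sub>M ?M \<rightarrow>\<^sub>M borel \<Otimes>\<^sub>M borel"
    by (intro measurable_Pair measurable_compose[OF measurable_fst M_borel]
        measurable_compose[OF measurable_snd M_borel])+
  have "bounded_kernel ?M W'"
  proof
    have "(\<lambda>z. g' (fst z, snd z)) \<in> borel_measurable (?M \<Otimes>\<^sub>M ?M)"
      "(\<lambda>z. g' (snd z, fst z)) \<in> borel_measurable (?M \<Otimes>\<^sub>M ?M)"
      by (rule pairs[THEN measurable_compose], measurable)+
    then show "(\<lambda>(x, y). W' x y) \<in> borel_measurable (?M \<Otimes>\<^sub>M ?M)"
      unfolding W'_def V_def case_prod_unfold by simp
  qed (auto simp: W'_def V_def add.commute)
  moreover have "AE z in ?M \<Otimes>\<^sub>M ?M. W (fst z) (snd z) = W' (fst z) (snd z)"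
  proof -
    have "{z \<in> space (?M \<Otimes>\<^sub>M ?M). (fst z, snd z) \<notin> N \<and> (snd z, fst z) \<notin> N} \<in> sets (?M \<Otimes>\<^sub>M ?M)"
      by measurable
    moreover have "AE x in ?M. AE y in ?M. (fst (x, y), snd (x, y)) \<notin> N \<and> (snd (x, y), fst (x, y)) \<notin> N"
      using restrict[OF ae1] restrict[OF ae2] by simp
    ultimately have "AE z in ?M \<Otimes>\<^sub>M ?M. (fst z, snd z) \<notin> N \<and> (snd z, fst z) \<notin> N"
      by (rule pair.AE_pair_measure)
    moreover have "W (fst z) (snd z) = W' (fst z) (snd z)"
      if "(fst z, snd z) \<notin> N" "(snd z, fst z) \<notin> N" "z \<in> space (?M \<Otimes>\<^sub>M ?M)" for z
    proof -
      obtain x y where z: "z = (x, y)" by fastforce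
      have xy: "x \<in> {0..1}" "y \<in> {0..1}"
        using that(3) by (auto simp: z space_pair_measure space_restrict_space)
      have "g (x, y) = g' (x, y)" "g (y, x) = g' (y, x)"
        using that N(1) by (auto simp: z)
      then have "g' (x, y) = W x y" "g' (y, x) = W y x"
        using xy by (auto simp: g_def)
      moreover have "W x y = W y x" "0 \<le> W x y" "W x y \<le> 1"
        using assms xy by (auto simp: graphon_def)
      ultimately show ?thesis by (simp add: z W'_def V_def)
    qed
    ultimately show ?thesis using AE_space by (elim AE_mp) auto
  qed
  ultimately show thesis by (rule that)
qed

text \<open>Two distinct coordinates have the product law, so each edge factor agrees almost
  everywhere. There are finitely many edges, hence so do the products.\<close>

lemma graphon_density_eq_kernel_density:
  fixes H :: "'v::linorder pair_pre_digraph"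
  assumes "bounded_kernel (restrict_space lborel {0..1}) W'" "pair_graph H"
    and ae: "AE z in restrict_space lborel {0..1} \<Otimes>\<^sub>M restrict_space lborel {0..1}.
           W (fst z) (snd z) = W' (fst z) (snd z)"
  shows "graphon_density H W = kernel_density (restrict_space lborel {0..1}) W' H"
proof -
  let ?M = "restrict_space lborel {0..1::real}"
  interpret bounded_kernel ?M W' by fact
  interpret H: pair_graph H by fact
  let ?E = "{(u, v). (u, v) \<in> parcs H \<and> u < v}" and ?P = "\<Pi>\<^sub>M u\<in>pverts H. ?M"
  have finE: "finite ?E" by (rule finite_subset[of _ "parcs H"]) auto
  have E: "u \<in> pverts H" "v \<in> pverts H" "u \<noteq> v" if "(u, v) \<in> ?E" for u v
    using that H.arc_fst_in_verts[of "(u, v)"] H.arc_snd_in_verts[of "(u, v)"] by auto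
  have "AE x in ?P. W (x u) (x v) = W' (x u) (x v)" if "(u, v) \<in> ?E" for u v
  proof -
    have "AE z in distr ?P (?M \<Otimes>\<^sub>M ?M) (\<lambda>x. (x u, x v)). W (fst z) (snd z) = W' (fst z) (snd z)"
      unfolding distr_PiM_two_components[OF E[OF that]] by (rule ae)
    then show ?thesis
      using E[OF that] by (auto dest!: AE_distrD[rotated])
  qed
  then have "AE x in ?P. \<forall>e\<in>?E. W (x (fst e)) (x (snd e)) = W' (x (fst e)) (x (snd e))"
    using finE by (intro AE_finite_allI) (auto simp: case_prod_unfold)
  then have "AE x in ?P. (\<Prod>(u, v)\<in>?E. W (x u) (x v)) = (\<Prod>(u, v)\<in>?E. W' (x u) (x v))"
    by eventually_elim (auto intro!: prod.cong)
  moreover have "(\<lambda>x. \<Prod>(u, v)\<in>?E. W' (x u) (x v)) \<in> borel_measurable ?P"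
    unfolding case_prod_unfold
  proof (rule borel_measurable_prod)
    fix e assume "e \<in> {p. (fst p, snd p) \<in> parcs H \<and> fst p < snd p}"
    then have [simp]: "fst e \<in> pverts H" "snd e \<in> pverts H" using E[of "fst e" "snd e"] by auto
    show "(\<lambda>x. W' (x (fst e)) (x (snd e))) \<in> borel_measurable ?P" by measurable
  qed
  ultimately show ?thesis
    unfolding graphon_density_def kernel_density_def by (intro integral_completion_AE_eq)
qed

section \<open>Multiplication graphs modulo a prime\<close>

text \<open>Every divisor of \<open>a * b\<close> is a product of a divisor of \<open>a\<close> and
  a divisor of \<open>b\<close>.\<close>

lemma card_divisors_mult_le:
  fixes a b :: nat
  assumes "a > 0" "b > 0"
  shows "card {d. d dvd a * b} \<le> card {d. d dvd a} * card {d. d dvd b}"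
proof -
  have "{d. d dvd a * b} \<subseteq> (\<lambda>(x, y). x * y) ` ({d. d dvd a} \<times> {d. d dvd b})"
    by (auto simp: image_iff dest!: division_decomp)
  then have "card {d. d dvd a * b} \<le> card ({d. d dvd a} \<times> {d. d dvd b})"
    using assms by (intro surj_card_le) auto
  then show ?thesis by (simp add: card_cartesian_product)
qed

lemma card_divisors_prime_power_le:
  fixes p :: nat
  assumes "prime p"
  shows "card {d. d dvd p ^ a} \<le> Suc a"
proof -
  have "{d. d dvd p ^ a} \<subseteq> (\<lambda>i. p ^ i) ` {..a}"
    using assms by (auto simp: divides_primepow_nat)
  then have "card {d. d dvd p ^ a} \<le> card {..a}"
    by (intro surj_card_le) auto
  then show ?thesis by simp
qed

text \<open>Exponential growth beats polynomial growth. The constant \<open>K\<close> is the price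
  paid for each small prime in the divisor bound.\<close>

lemma Suc_power_le_const_mult_power_2:
  obtains K :: nat where "K \<ge> 1" "\<And>a. Suc a ^ r \<le> K * 2 ^ a"
proof -
  have "(\<lambda>a. real (Suc a) ^ r / 2 ^ a) \<longlonglongrightarrow> 0"
    by real_asymp
  then have "Bseq (\<lambda>a. real (Suc a) ^ r / 2 ^ a)"
    by (rule convergent_imp_Bseq[OF convergentI])
  then obtain B where B: "\<And>a. norm (real (Suc a) ^ r / 2 ^ a) \<le> B"
    unfolding Bseq_def by auto
  define K where "K = max 1 (nat \<lceil>B\<rceil>)"
  have "Suc a ^ r \<le> K * 2 ^ a" for a
  proof -
    have "real (Suc a) ^ r \<le> B * 2 ^ a"
      using B[of a] by (simp add: divide_le_eq)
    also have "\<dots> \<le> real K * 2 ^ a"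
      unfolding K_def of_nat_max
      by (intro mult_right_mono) (auto simp: le_max_iff_disj real_nat_ceiling_ge)
    finally have "real (Suc a ^ r) \<le> real (K * 2 ^ a)" by simp
    then show ?thesis by (simp only: of_nat_le_iff)
  qed
  then show thesis by (intro that[of K]) (auto simp: K_def)
qed

text \<open>Only primes below \<open>2 ^ r\<close> contribute a factor \<open>K\<close>: for \<open>p \<ge> 2 ^ r\<close> we have
  \<open>(a + 1) ^ r \<le> 2 ^ (a * r) \<le> p ^ a\<close>.\<close>

lemma card_divisors_power_le:
  obtains K :: nat where "K \<ge> 1" "\<And>n. n > 0 \<Longrightarrow> card {d. d dvd n} ^ r \<le> K * n"
proof -
  obtain K :: nat where K: "K \<ge> 1" "\<And>a. Suc a ^ r \<le> K * 2 ^ a"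
    using Suc_power_le_const_mult_power_2[of r] by metis
  define small where "small n = {p \<in> prime_factors n. p < 2 ^ r}" for n :: nat
  \<comment> \<open>The induction removes the full power of one prime; a factor \<open>K\<close> is
    spent exactly when that prime is small.\<close>
  have "card {d. d dvd n} ^ r \<le> K ^ card (small n) * n" if "n > 0" for n
    using that
  proof (induction n rule: less_induct)
    case (less n)
    show ?case
    proof (cases "n = 1")
      case False
      then obtain p where p: "prime p" "p dvd n" using prime_factor_nat by blast
      define a where "a = multiplicity p n"
      obtain m where m: "n = p ^ a * m" "\<not> p dvd m"
        using multiplicity_decompose'[of n p] less.prems p(1)
        by (metis a_def neq0_conv not_prime_unit)
      have "a > 0" using p less.prems by (simp add: a_def prime_multiplicity_gt_zero_iff)
      have "m > 0" using m less.prems by (cases m) auto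
      have "1 < p ^ a" using p(1) \<open>a > 0\<close> by (metis one_less_power prime_gt_1_nat)
      then have "m < n" using \<open>m > 0\<close> by (simp add: m(1))
      have pf: "prime_factors n = insert p (prime_factors m)"
        using p(1) \<open>a > 0\<close> \<open>m > 0\<close> unfolding m(1)
        by (subst prime_factors_product) (auto simp: prime_factors_power prime_prime_factors)
      have "p \<notin> prime_factors m" using m(2) by auto
      have fin: "finite (small m)" by (simp add: small_def)
      have step: "Suc a ^ r * K ^ card (small m) \<le> K ^ card (small n) * p ^ a"
      proof (cases "p < 2 ^ r")
        case True
        then have "small n = insert p (small m)" by (auto simp: small_def pf)
        moreover have "p \<notin> small m" using \<open>p \<notin> prime_factors m\<close> by (simp add: small_def)
        ultimately have "card (small n) = Suc (card (small m))" using fin by simp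
        moreover have "Suc a ^ r \<le> K * p ^ a"
        proof -
          have "2 ^ a \<le> p ^ a" using p(1) by (intro power_mono prime_ge_2_nat) auto
          then show ?thesis using K(2)[of a] by (meson le_trans mult_le_mono2)
        qed
        ultimately show ?thesis by (simp add: mult_ac mult_le_mono)
      next
        case False
        then have "small n = small m" by (auto simp: small_def pf)
        moreover have "Suc a ^ r \<le> p ^ a"
        proof -
          have "Suc a \<le> 2 ^ a" by (simp add: Suc_le_eq)
          then have "Suc a ^ r \<le> (2 ^ a) ^ r" by (intro power_mono) auto
          also have "\<dots> = (2 ^ r) ^ a" by (simp add: power_mult[symmetric] mult.commute)
          also have "\<dots> \<le> p ^ a" using False by (intro power_mono) auto
          finally show ?thesis .
        qed
        ultimately show ?thesis by (simp add: mult.commute)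
      qed
      have "card {d. d dvd n} \<le> card {d. d dvd p ^ a} * card {d. d dvd m}"
        unfolding m(1) using p(1) \<open>m > 0\<close> by (intro card_divisors_mult_le) (auto simp: prime_gt_0_nat)
      also have "\<dots> \<le> Suc a * card {d. d dvd m}"
        using card_divisors_prime_power_le[OF p(1)] by (intro mult_le_mono1)
      finally have "card {d. d dvd n} ^ r \<le> Suc a ^ r * card {d. d dvd m} ^ r"
        by (metis power_mono power_mult_distrib zero_le)
      also have "\<dots> \<le> Suc a ^ r * (K ^ card (small m) * m)"
        using less.IH[OF \<open>m < n\<close> \<open>m > 0\<close>] by (intro mult_le_mono2)
      also have "\<dots> \<le> K ^ card (small n) * p ^ a * m"
        using mult_le_mono1[OF step, of m] by (simp add: mult_ac)
      finally show ?thesis by (simp add: m(1) mult_ac)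
    qed (simp add: small_def)
  qed
  \<comment> \<open>There are at most \<open>2 ^ r\<close> small primes, which makes the constant
    independent of \<open>n\<close>.\<close>
  moreover have "K ^ card (small n) \<le> K ^ 2 ^ r" for n
  proof -
    have "card (small n) \<le> card {..<2 ^ r :: nat}"
      by (intro card_mono) (auto simp: small_def)
    then show ?thesis using K(1) by (intro power_increasing) auto
  qed
  ultimately have "card {d. d dvd n} ^ r \<le> K ^ 2 ^ r * n" if "n > 0" for n
    using that by (meson le_trans mult_le_mono1)
  then show thesis using K(1) by (intro that[of "K ^ 2 ^ r"]) auto
qed

section \<open>Closed walks in multiplication graphs\<close>

text \<open>The vertices are the nonzero residues. For prime \<open>m\<close>, one endpoint and the
  label \<open>x * y mod m\<close> of an edge therefore determine the other endpoint.\<close>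

definition mult_graph :: "nat \<Rightarrow> nat \<Rightarrow> nat pair_pre_digraph" where
  "mult_graph m X =
     \<lparr>pverts = {1..<m},
      parcs = {(x, y). x \<in> {1..<m} \<and> y \<in> {1..<m} \<and> x \<noteq> y \<and> x * y mod m \<le> X}\<rparr>"

lemma pair_graph_mult_graph: "pair_graph (mult_graph m X)"
proof
  show "finite (parcs (mult_graph m X))"
    by (rule finite_subset[of _ "{1..<m} \<times> {1..<m}"]) (auto simp: mult_graph_def)
  show "symmetric (with_proj (mult_graph m X))"
    by (auto simp: symmetric_def mult_graph_def sym_def mult.commute)
qed (auto simp: mult_graph_def)

lemma prime_mult_mod_cancel:
  fixes m x y z :: nat
  assumes "prime m" "x \<in> {1..<m}" "y < m" "z < m" "x * y mod m = x * z mod m"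
  shows "y = z"
proof -
  have "coprime x m"
    using assms by (metis atLeastLessThan_iff coprime_commute nat_dvd_not_less prime_imp_coprime_nat
        less_le_trans zero_less_one)
  moreover have "[x * y = x * z] (mod m)" using assms(5) by (simp add: cong_def)
  ultimately have "[y = z] (mod m)" by (simp add: cong_mult_lcancel_nat)
  then show ?thesis using assms by (simp add: cong_less_modulus_unique_nat)
qed

lemma prime_mult_mod_pos:
  fixes m x y :: nat
  assumes "prime m" "x \<in> {1..<m}" "y \<in> {1..<m}"
  shows "x * y mod m \<in> {1..<m}"
proof -
  have "\<not> m dvd x * y"
    using assms by (auto simp: prime_dvd_mult_iff dest: nat_dvd_not_less)
  then have "0 < x * y mod m" by (simp add: mod_greater_zero_iff_not_dvd)
  then show ?thesis using assms by auto
qed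

text \<open>Multiplication by \<open>x\<close> permutes the nonzero residues, so each label in
  \<open>{1..X}\<close> occurs; at most one of the resulting neighbours is lost to the ban on
  loops.\<close>

lemma card_mult_graph_neighbours_ge:
  assumes "prime m" "x \<in> {1..<m}" "X < m"
  shows "X - 1 \<le> card {y \<in> {1..<m}. x \<noteq> y \<and> x * y mod m \<le> X}"
proof -
  let ?f = "\<lambda>y. x * y mod m" and ?A = "{y \<in> {1..<m}. x * y mod m \<le> X}"
  have "inj_on ?f {1..<m}"
    by (rule inj_onI, rule prime_mult_mod_cancel[OF assms(1,2)]) auto
  moreover have "?f ` {1..<m} \<subseteq> {1..<m}"
    using prime_mult_mod_pos[OF assms(1,2)] by blast
  ultimately have "?f ` {1..<m} = {1..<m}" by (simp add: endo_inj_surj)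
  then have "{1..X} \<subseteq> ?f ` {1..<m}" using assms(3) by auto
  then have "{1..X} \<subseteq> ?f ` ?A" by fastforce
  then have "card {1..X} \<le> card ?A" by (intro surj_card_le) auto
  moreover have "card ?A - 1 \<le> card (?A - {x})"
    by (simp add: card_Diff_singleton_if)
  moreover have "?A - {x} = {y \<in> {1..<m}. x \<noteq> y \<and> x * y mod m \<le> X}" by auto
  ultimately show ?thesis by simp
qed

text \<open>Degenerate closed walks \<open>x, y, x, z\<close> already suffice: \<open>y\<close> and
  \<open>z\<close> range independently over the neighbours of \<open>x\<close>.\<close>

lemma hom_count_cycle_4_mult_graph_ge:
  assumes "prime m" "X < m"
  shows "(m - 1) * (X - 1)\<^sup>2 \<le> hom_count (cycle_graph 4) (mult_graph m X)"
proof -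
  define Nb where "Nb x = {y \<in> {1..<m}. x \<noteq> y \<and> x * y mod m \<le> X}" for x
  define S where "S = {f \<in> pverts (cycle_graph 4) \<rightarrow>\<^sub>E pverts (mult_graph m X).
      \<forall>u v. (u, v) \<in> parcs (cycle_graph 4) \<longrightarrow> (f u, f v) \<in> parcs (mult_graph m X)}"
  define \<phi> where "\<phi> = (\<lambda>(x, y, z). \<lambda>i\<in>{..<4::nat}. if i = 1 then y else if i = 3 then z else (x::nat))"
  let ?D = "Sigma {1..<m} (\<lambda>x. Nb x \<times> Nb x)"
  have fin: "finite S"
    unfolding S_def
    by (rule finite_subset[of _ "pverts (cycle_graph 4) \<rightarrow>\<^sub>E pverts (mult_graph m X)"])
      (auto simp: cycle_graph_def mult_graph_def intro!: finite_PiE)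
  have "inj_on \<phi> ?D"
  proof (rule inj_onI)
    fix s t assume "\<phi> s = \<phi> t"
    then have "\<phi> s 0 = \<phi> t 0" "\<phi> s 1 = \<phi> t 1" "\<phi> s 3 = \<phi> t 3" by auto
    then show "s = t" by (auto simp: \<phi>_def case_prod_unfold prod_eq_iff)
  qed
  moreover have "\<phi> ` ?D \<subseteq> S"
  proof
    fix f assume "f \<in> \<phi> ` ?D"
    then obtain x y z where xyz: "x \<in> {1..<m}" "y \<in> Nb x" "z \<in> Nb x" "f = \<phi> (x, y, z)" by auto
    have vals: "f 0 = x" "f (Suc 0) = y" "f 2 = x" "f 3 = z" by (simp_all add: xyz(4) \<phi>_def)
    have edge: "(f u, f (Suc u mod 4)) \<in> parcs (mult_graph m X)
        \<and> (f (Suc u mod 4), f u) \<in> parcs (mult_graph m X)" if "u < 4" for u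
    proof -
      from that consider "u = 0" | "u = 1" | "u = 2" | "u = 3" by linarith
      then show ?thesis
        using xyz(1-3)
        by cases (auto simp: vals Nb_def mult_graph_def mult.commute numeral_2_eq_2[symmetric]
            numeral_3_eq_3[symmetric])
    qed
    have "f \<in> {..<4} \<rightarrow>\<^sub>E {1..<m}"
      using xyz by (auto simp: \<phi>_def Nb_def)
    with edge show "f \<in> S" by (auto simp: S_def cycle_graph_def mult_graph_def)
  qed
  ultimately have "card ?D \<le> card S" using fin by (intro card_inj_on_le)
  have "(m - 1) * (X - 1)\<^sup>2 = (\<Sum>x\<in>{1..<m}. (X - 1)\<^sup>2)" by simp
  also have "\<dots> \<le> (\<Sum>x\<in>{1..<m}. card (Nb x) * card (Nb x))"
    unfolding power2_eq_square Nb_def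
    by (intro sum_mono mult_le_mono card_mult_graph_neighbours_ge assms)
  also have "\<dots> = card ?D"
    by (subst card_SigmaI) (auto simp: Nb_def card_cartesian_product)
  also note \<open>card ?D \<le> card S\<close>
  finally show ?thesis by (simp add: hom_count_def S_def)
qed

text \<open>Alternate edge labels of a closed walk have the same product modulo \<open>m\<close>, hence, being small,
  the same product; so the labels at odd positions are divisors of a given integer.\<close>

lemma hom_count_cycle_mult_graph_le:
  assumes m: "prime m" and k: "k \<ge> 2" and X: "X ^ k < m"
    and D: "\<And>n. 0 < n \<Longrightarrow> n \<le> X ^ k \<Longrightarrow> card {d. d dvd n} \<le> D"
  shows "hom_count (cycle_graph (2 * k)) (mult_graph m X) \<le> (m - 1) * (X ^ k * D ^ k)"
proof -
  define S where "S = {f \<in> pverts (cycle_graph (2 * k)) \<rightarrow>\<^sub>E pverts (mult_graph m X).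
      \<forall>u v. (u, v) \<in> parcs (cycle_graph (2 * k)) \<longrightarrow> (f u, f v) \<in> parcs (mult_graph m X)}"
  \<comment> \<open>The labels at even and odd positions, restricted to \<open>{..<k}\<close> so
    that they lie in extensional function spaces. The outer reduction of the index in
    \<open>b\<close> accounts for the closing edge.\<close>
  define a where "a f = (\<lambda>i\<in>{..<k}. f (2 * i) * f (2 * i + 1) mod m)" for f :: "nat \<Rightarrow> nat"
  define b where "b f = (\<lambda>i\<in>{..<k}. f (2 * i + 1) * f ((2 * i + 2) mod (2 * k)) mod m)"
    for f :: "nat \<Rightarrow> nat"
  define A where "A = {..<k} \<rightarrow>\<^sub>E {1..X}"
  define B where "B s = {..<k} \<rightarrow>\<^sub>E {d. d dvd (\<Prod>i<k. s i)}" for s :: "nat \<Rightarrow> nat"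
  have vert: "f i \<in> {1..<m}" if "f \<in> S" "i < 2 * k" for f i
    using that by (auto simp: S_def cycle_graph_def mult_graph_def PiE_iff)
  have label: "f i * f (Suc i mod (2 * k)) mod m \<in> {1..X}" if "f \<in> S" "i < 2 * k" for f i
  proof -
    have "Suc i mod (2 * k) < 2 * k" using k by simp
    then have "(i, Suc i mod (2 * k)) \<in> parcs (cycle_graph (2 * k))"
      using that by (simp add: cycle_graph_def)
    then have "(f i, f (Suc i mod (2 * k))) \<in> parcs (mult_graph m X)" using that by (simp add: S_def)
    then show ?thesis using prime_mult_mod_pos[OF m] by (auto simp: mult_graph_def Suc_le_eq)
  qed
  have a_range: "a f i \<in> {1..X}" if "f \<in> S" "i < k" for f i
    using label[OF that(1), of "2 * i"] that(2) by (simp add: a_def)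
  have b_range: "b f i \<in> {1..X}" if "f \<in> S" "i < k" for f i
    using label[OF that(1), of "2 * i + 1"] that(2) by (simp add: b_def)
  have prod_eq: "(\<Prod>i<k. a f i) = (\<Prod>i<k. b f i)" if "f \<in> S" for f
  proof -
    have "[(\<Prod>i<k. a f i) = (\<Prod>i<k. f (2 * i) * f (2 * i + 1))] (mod m)"
      by (intro cong_prod) (simp add: a_def cong_def)
    \<comment> \<open>Both sides multiply all vertices once; only the vertices at even positions are
      shifted cyclically.\<close>
    also have "(\<Prod>i<k. f (2 * i) * f (2 * i + 1)) = (\<Prod>i<k. f (2 * i + 1) * f ((2 * i + 2) mod (2 * k)))"
    proof -
      obtain k' where k': "k = Suc k'" using k by (cases k) auto
      have "(\<Prod>i<k. f ((2 * i + 2) mod (2 * k))) = (\<Prod>i<k'. f ((2 * i + 2) mod (2 * k))) * f 0"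
        by (simp add: k')
      also have "(\<Prod>i<k'. f ((2 * i + 2) mod (2 * k))) = (\<Prod>i<k'. f (2 * Suc i))"
        by (intro prod.cong) (auto simp: k')
      also have "\<dots> * f 0 = (\<Prod>i<k. f (2 * i))"
        unfolding k' prod.lessThan_Suc_shift by simp
      finally show ?thesis by (simp add: prod.distrib)
    qed
    also have "[\<dots> = (\<Prod>i<k. b f i)] (mod m)"
      by (intro cong_prod) (simp add: b_def cong_def)
    finally have "[(\<Prod>i<k. a f i) = (\<Prod>i<k. b f i)] (mod m)" .
    \<comment> \<open>Both products stay below \<open>m\<close>, so the congruence is an equality of
      integers.\<close>
    moreover have "(\<Prod>i<k. a f i) \<le> X ^ k" "(\<Prod>i<k. b f i) \<le> X ^ k"
      using prod_mono[of "{..<k}" "a f" "\<lambda>_. X"] prod_mono[of "{..<k}" "b f" "\<lambda>_. X"]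
        a_range[OF that] b_range[OF that] by auto
    ultimately show ?thesis using X by (simp add: cong_less_modulus_unique_nat)
  qed
  \<comment> \<open>From the starting vertex and the labels, the walk is recovered vertex by vertex
    through cancellation modulo \<open>m\<close>.\<close>
  have "inj_on (\<lambda>f. (f 0, a f, b f)) S"
  proof (rule inj_onI)
    fix f g assume f: "f \<in> S" and g: "g \<in> S" and "(f 0, a f, b f) = (g 0, a g, b g)"
    then have eq: "f 0 = g 0" "\<And>i. a f i = a g i" "\<And>i. b f i = b g i" by auto
    have "f i = g i" if "i < 2 * k" for i
      using that
    proof (induction i)
      case (Suc i)
      have "f i * f (Suc i) mod m = g i * g (Suc i) mod m"
      proof (cases "even i")
        case True
        then obtain j where "i = 2 * j" by (elim evenE)
        then show ?thesis using eq(2)[of j] Suc.prems by (simp add: a_def)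
      next
        case False
        then obtain j where "i = 2 * j + 1" by (elim oddE)
        then show ?thesis using eq(3)[of j] Suc.prems by (simp add: b_def)
      qed
      then have "f i * f (Suc i) mod m = f i * g (Suc i) mod m" using Suc by simp
      moreover have "f i \<in> {1..<m}" "f (Suc i) < m" "g (Suc i) < m"
        using vert[OF f, of i] vert[OF f Suc.prems] vert[OF g Suc.prems] Suc.prems by auto
      ultimately show ?case by (metis prime_mult_mod_cancel[OF m])
    qed (use eq in simp)
    moreover have "f \<in> extensional {..<2 * k}" "g \<in> extensional {..<2 * k}"
      using f g by (auto simp: S_def cycle_graph_def PiE_def)
    ultimately show "f = g" by (intro extensionalityI) auto
  qed
  moreover have "(\<lambda>f. (f 0, a f, b f)) ` S \<subseteq> {1..<m} \<times> Sigma A B"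
  proof
    fix t assume "t \<in> (\<lambda>f. (f 0, a f, b f)) ` S"
    then obtain f where f: "f \<in> S" and t: "t = (f 0, a f, b f)" by auto
    have "a f \<in> A" unfolding A_def
      using a_range[OF f] by (intro PiE_I) (auto simp: a_def)
    moreover have "b f \<in> B (a f)" unfolding B_def prod_eq[OF f]
      by (intro PiE_I) (auto simp: b_def)
    ultimately show "t \<in> {1..<m} \<times> Sigma A B" using vert[OF f, of 0] k by (simp add: t)
  qed
  moreover
  have finA: "finite A" unfolding A_def by (intro finite_PiE) auto
  have B_card: "finite (B s)" "card (B s) \<le> D ^ k" if "s \<in> A" for s
  proof -
    have s: "s i \<in> {1..X}" if "i < k" for i
      using PiE_mem[OF \<open>s \<in> A\<close>[unfolded A_def]] that by simp
    have pos: "0 < (\<Prod>i<k. s i)" using s by (intro prod_pos) (auto simp: Suc_le_eq)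
    have le: "(\<Prod>i<k. s i) \<le> X ^ k"
      using prod_mono[of "{..<k}" s "\<lambda>_. X"] s by auto
    show "finite (B s)" unfolding B_def using pos by (intro finite_PiE) auto
    show "card (B s) \<le> D ^ k"
      unfolding B_def using D[OF pos le] by (simp add: card_PiE power_mono)
  qed
  ultimately have "card S \<le> card ({1..<m} \<times> Sigma A B)"
    using finA by (intro card_inj_on_le) auto
  also have "\<dots> = (m - 1) * (\<Sum>s\<in>A. card (B s))"
    using finA B_card by (simp add: card_cartesian_product card_SigmaI)
  also have "\<dots> \<le> (m - 1) * (\<Sum>s\<in>A. D ^ k)"
    using B_card by (intro mult_le_mono2 sum_mono)
  also have "(\<Sum>s\<in>A. D ^ k) = X ^ k * D ^ k"
    by (simp add: A_def card_PiE)
  finally show ?thesis by (simp add: hom_count_def S_def)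
qed

section \<open>The domination exponent of even cycles\<close>

lemma (in bounded_kernel) kernel_density_even_cycle:
  assumes "k \<ge> 2"
  shows "kernel_density M W (cycle_graph (2 * k)) = cycle_moment (2 * k - 2)"
proof -
  have "1 \<le> 2 * k - 2" "2 * k - 2 + 2 = 2 * k" using assms by auto
  then show ?thesis using kernel_density_cycle_graph by metis
qed

lemma (in bounded_kernel) kernel_density_cycle_bounds:
  assumes "k \<ge> 2"
  shows "0 \<le> kernel_density M W (cycle_graph (2 * k))"
    and "kernel_density M W (cycle_graph (2 * k)) \<le> 1"
    and "k = 2 ^ j \<Longrightarrow> edge_density ^ (2 * k) \<le> kernel_density M W (cycle_graph (2 * k))"
    and "kernel_density M W (cycle_graph 4) ^ (k - 1)
      \<le> edge_density ^ (k - 2) * kernel_density M W (cycle_graph (2 * k))"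
proof -
  note eq = kernel_density_even_cycle[OF assms]
  show "0 \<le> kernel_density M W (cycle_graph (2 * k))"
    "kernel_density M W (cycle_graph (2 * k)) \<le> 1"
    by (simp_all add: eq cycle_moment_nonneg cycle_moment_le_1)
  show "edge_density ^ (2 * k) \<le> kernel_density M W (cycle_graph (2 * k))" if "k = 2 ^ j"
    unfolding eq by (rule edge_density_power_le_cycle_moment[OF that])
  have "Suc (k - 2) = k - 1" "2 * Suc (k - 2) = 2 * k - 2" using assms by auto
  then show "kernel_density M W (cycle_graph 4) ^ (k - 1)
      \<le> edge_density ^ (k - 2) * kernel_density M W (cycle_graph (2 * k))"
    using cycle_moment_2_power_le[of "k - 2"] kernel_density_even_cycle[of 2] by (simp add: eq)
qed

text \<open>The witness \<open>p\<close> is the edge density of the target.\<close>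

lemma hom_density_cycle_bounds:
  assumes "valid_target \<tau>"
  shows "\<exists>p\<ge>0. \<forall>k\<ge>2.
      0 \<le> hom_density (cycle_graph (2 * k)) \<tau> \<and> hom_density (cycle_graph (2 * k)) \<tau> \<le> 1
      \<and> ((\<exists>j. k = 2 ^ j) \<longrightarrow> p ^ (2 * k) \<le> hom_density (cycle_graph (2 * k)) \<tau>)
      \<and> hom_density (cycle_graph 4) \<tau> ^ (k - 1) \<le> p ^ (k - 2) * hom_density (cycle_graph (2 * k)) \<tau>"
proof -
  \<comment> \<open>Both kinds of target are reduced to a kernel, over a space whose type is left
    generic.\<close>
  have *: ?thesis if "bounded_kernel M W"
    and eq: "\<And>k. k \<ge> 2 \<Longrightarrow> hom_density (cycle_graph (2 * k)) \<tau> = kernel_density M W (cycle_graph (2 * k))"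
    for M :: "'c measure" and W
  proof -
    interpret bounded_kernel M W by fact
    have "hom_density (cycle_graph 4) \<tau> = kernel_density M W (cycle_graph 4)"
      using eq[of 2] by simp
    then show ?thesis
      using kernel_density_cycle_bounds edge_density_nonneg
      by (intro exI[of _ edge_density]) (auto simp: eq)
  qed
  show ?thesis
  proof (cases \<tau>)
    case (Graph T)
    then have T: "pair_graph T" "pverts T \<noteq> {}" using assms by auto
    show ?thesis
    proof (rule *[OF bounded_kernel_adjacency[OF T]])
      fix k :: nat assume "k \<ge> 2"
      then show "hom_density (cycle_graph (2 * k)) \<tau> = kernel_density (uniform_count_measure (pverts T))
          (\<lambda>x y. of_bool ((x, y) \<in> parcs T)) (cycle_graph (2 * k))"
        using T by (simp add: Graph graph_density_eq_kernel_density pair_graph_cycle_graph)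
    qed
  next
    case (Graphon W)
    then obtain W' where W': "bounded_kernel (restrict_space lborel {0..1}) W'"
      and ae: "AE z in restrict_space lborel {0..1} \<Otimes>\<^sub>M restrict_space lborel {0..1}.
           W (fst z) (snd z) = W' (fst z) (snd z)"
      using graphon_Borel_version[of W] assms by auto
    show ?thesis
    proof (rule *[OF W'])
      fix k :: nat assume "k \<ge> 2"
      then show "hom_density (cycle_graph (2 * k)) \<tau>
          = kernel_density (restrict_space lborel {0..1}) W' (cycle_graph (2 * k))"
        using graphon_density_eq_kernel_density[OF W' pair_graph_cycle_graph[of "2 * k"] ae]
        by (simp add: Graphon)
    qed
  qed
qed

section \<open>Elimination of the edge density\<close>

text \<open>Inserting \<open>p \<le> u powr (1 / (2 * k))\<close> into
  \<open>s ^ (k - 1) \<le> p ^ (k - 2) * u\<close> bounds \<open>s ^ (k - 1)\<close> by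
  \<open>u powr ((3 * k - 2) / (2 * k))\<close>, which yields this exponent.\<close>

definition cycle_exponent :: "nat \<Rightarrow> real" where
  "cycle_exponent k = 2 * real k * (real k - 1) / (3 * real k - 2)"

lemma density_bounds_ln:
  fixes s u p :: real
  assumes "k \<ge> 3" "0 < s" "0 \<le> p" "0 \<le> u" "p ^ (2 * k) \<le> u" "s ^ (k - 1) \<le> p ^ (k - 2) * u"
  shows "0 < p" "0 < u" "2 * real k * ln p \<le> ln u"
    and "(real k - 1) * ln s \<le> (real k - 2) * ln p + ln u"
proof -
  have pos: "0 < p ^ (k - 2) * u" using assms(2,6) by (meson less_le_trans zero_less_power)
  \<comment> \<open>As \<open>k \<ge> 3\<close>, the exponent \<open>k - 2\<close> is positive and
    \<open>p = 0\<close> would make the product vanish.\<close>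
  show p: "0 < p"
    using pos assms(1,3) by (cases "p = 0") (auto simp: power_0_left)
  then show u: "0 < u" using pos assms(4) by (cases "u = 0") auto
  have "ln (p ^ (2 * k)) \<le> ln u" using p u assms(5) by (subst ln_le_cancel_iff) auto
  then show "2 * real k * ln p \<le> ln u" using p by (simp add: ln_realpow)
  have "ln (s ^ (k - 1)) \<le> ln (p ^ (k - 2) * u)"
    using pos assms(2,6) by (subst ln_le_cancel_iff) auto
  then show "(real k - 1) * ln s \<le> (real k - 2) * ln p + ln u"
    using p u assms(1,2) by (simp add: ln_realpow ln_mult)
qed

lemma density_bounds_domination:
  fixes s u p :: real
  assumes "k \<ge> 3" "0 \<le> s" "0 \<le> p" "0 \<le> u" "p ^ (2 * k) \<le> u" "s ^ (k - 1) \<le> p ^ (k - 2) * u"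
  shows "s powr cycle_exponent k \<le> u"
proof (cases "s = 0")
  case False
  then have "0 < s" using assms by simp
  note ln = density_bounds_ln[OF assms(1) this assms(3-6)]
  have k: "real k \<ge> 3" using assms(1) by simp
  \<comment> \<open>The second inequality times \<open>2 * k\<close> and the first times
    \<open>k - 2\<close> combine so that \<open>ln p\<close> cancels.\<close>
  have "2 * real k * ((real k - 1) * ln s) \<le> 2 * real k * ((real k - 2) * ln p + ln u)"
    using ln(4) k by (intro mult_left_mono) auto
  also have "\<dots> \<le> (real k - 2) * ln u + 2 * real k * ln u"
    using mult_left_mono[OF ln(3), of "real k - 2"] k by (simp add: algebra_simps)
  finally have "2 * real k * (real k - 1) * ln s \<le> (3 * real k - 2) * ln u"
    by (simp add: algebra_simps)
  then have "cycle_exponent k * ln s \<le> ln u"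
    using k by (simp add: cycle_exponent_def field_simps)
  then have "exp (cycle_exponent k * ln s) \<le> exp (ln u)" by simp
  then show ?thesis using \<open>0 < s\<close> ln(2) by (simp add: powr_def)
qed (use assms in simp)

text \<open>Division by the negative \<open>ln (s n)\<close> turns the two inequalities into a lower
  and an upper bound for the quotient. Both bounds have the same limit when
  \<open>ln (u n) / ln (s n)\<close> tends to the extremal exponent.\<close>

lemma edge_exponent_tendsto:
  fixes s u p :: "nat \<Rightarrow> real"
  assumes k: "k \<ge> 3"
    and bounds: "\<And>n. n \<ge> 1 \<Longrightarrow> 0 \<le> s n \<and> s n \<le> 1 \<and> 0 \<le> p n \<and> 0 \<le> u n
      \<and> p n ^ (2 * k) \<le> u n \<and> s n ^ (k - 1) \<le> p n ^ (k - 2) * u n"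
    and lim: "(\<lambda>n. ln (u n) / ln (s n)) \<longlonglongrightarrow> cycle_exponent k"
  shows "(\<lambda>n. ln (p n) / ln (s n)) \<longlonglongrightarrow> (real k - 1) / (3 * real k - 2)"
proof (rule tendsto_sandwich)
  have k': "real k \<ge> 3" using k by simp
  have "0 < cycle_exponent k" using k' by (simp add: cycle_exponent_def)
  then have "\<forall>\<^sub>F n in sequentially. 0 < ln (u n) / ln (s n)"
    by (rule order_tendstoD(1)[OF lim])
  then have ev: "\<forall>\<^sub>F n in sequentially. ln (u n) / ln (s n) / (2 * real k) \<le> ln (p n) / ln (s n)
      \<and> ln (p n) / ln (s n) \<le> (real k - 1 - ln (u n) / ln (s n)) / (real k - 2)"
    using eventually_ge_at_top[of 1]
  proof eventually_elim
    case (elim n)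
    note b = bounds[OF elim(2)]
    \<comment> \<open>Division by zero yields 0, so a positive quotient has a nonzero denominator;
      as \<open>ln 0 = 0\<close>, this excludes \<open>s n = 0\<close> as well as
      \<open>s n = 1\<close>.\<close>
    have "ln (s n) \<noteq> 0" using elim(1) by auto
    then have "s n \<noteq> 0" "s n \<noteq> 1" by auto
    with b have s: "0 < s n" "ln (s n) < 0" by auto
    note ln = density_bounds_ln[OF k s(1), of "p n" "u n"]
    have "2 * real k * ln (p n) \<le> ln (u n)" using ln b by auto
    from divide_right_mono_neg[OF this, of "ln (s n)"]
    have "ln (u n) / ln (s n) \<le> 2 * real k * ln (p n) / ln (s n)" using s(2) by simp
    moreover have "(real k - 1) * ln (s n) \<le> (real k - 2) * ln (p n) + ln (u n)" using ln b by auto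
    from divide_right_mono_neg[OF this, of "ln (s n)"]
    have "((real k - 2) * ln (p n) + ln (u n)) / ln (s n) \<le> (real k - 1) * ln (s n) / ln (s n)"
      using s(2) by simp
    ultimately show ?case using k' s(2) by (auto simp: field_simps)
  qed
  show "\<forall>\<^sub>F n in sequentially. ln (u n) / ln (s n) / (2 * real k) \<le> ln (p n) / ln (s n)"
    "\<forall>\<^sub>F n in sequentially. ln (p n) / ln (s n) \<le> (real k - 1 - ln (u n) / ln (s n)) / (real k - 2)"
    using ev by (auto elim: eventually_mono)
  have "(\<lambda>n. ln (u n) / ln (s n) / (2 * real k)) \<longlonglongrightarrow> cycle_exponent k / (2 * real k)"
    using k' by (intro tendsto_intros lim) auto
  also have "cycle_exponent k / (2 * real k) = (real k - 1) / (3 * real k - 2)"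
    using k' by (simp add: cycle_exponent_def)
  finally show "(\<lambda>n. ln (u n) / ln (s n) / (2 * real k)) \<longlonglongrightarrow> (real k - 1) / (3 * real k - 2)" .
  have "(\<lambda>n. (real k - 1 - ln (u n) / ln (s n)) / (real k - 2))
      \<longlonglongrightarrow> (real k - 1 - cycle_exponent k) / (real k - 2)"
    using k' by (intro tendsto_intros lim) auto
  also have "real k - 1 - cycle_exponent k = (real k - 1) * (real k - 2) / (3 * real k - 2)"
    using k' by (simp add: cycle_exponent_def field_simps)
  also have "\<dots> / (real k - 2) = (real k - 1) / (3 * real k - 2)"
    using k' by simp
  finally show "(\<lambda>n. (real k - 1 - ln (u n) / ln (s n)) / (real k - 2))
      \<longlonglongrightarrow> (real k - 1) / (3 * real k - 2)" .
qed

section \<open>Optimality of the exponent\<close>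

text \<open>A smaller exponent, tested on multiplication graphs for all large primes
  \<open>m\<close>, would bound \<open>ln (m - 1)\<close> by a constant.\<close>

lemma domination_exponent_ge:
  assumes k: "k \<ge> 2"
    and c: "\<And>T :: nat pair_pre_digraph. pair_graph T \<Longrightarrow> pverts T \<noteq> {} \<Longrightarrow>
      graph_density (cycle_graph 4) T powr c \<le> graph_density (cycle_graph (2 * k)) T"
  shows "cycle_exponent k \<le> c"
proof (rule ccontr)
  assume "\<not> cycle_exponent k \<le> c"
  \<comment> \<open>A nonnegative exponent preserves the lower bound on \<open>ln s\<close> under
    multiplication, and it remains admissible because \<open>s \<le> 1\<close>.\<close>
  define c' where "c' = max c 0"
  have k': "real k \<ge> 2" using k by simp
  have "0 < cycle_exponent k" using k' by (simp add: cycle_exponent_def)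
  with \<open>\<not> cycle_exponent k \<le> c\<close> have c': "c' < cycle_exponent k" "0 \<le> c'" "c \<le> c'"
    by (auto simp: c'_def)
  \<comment> \<open>With \<open>L = ln (m - 1)\<close>, the leading terms are
    \<open>-(2 * k - 2) * L\<close> in the bound for \<open>ln u\<close> and
    \<open>-(3 - 2 / k) * L\<close> in that for \<open>ln s\<close>. So \<open>\<delta>\<close> is
    the coefficient of \<open>L\<close> left in \<open>c' * ln s \<le> ln u\<close>.\<close>
  define \<delta> where "\<delta> = 2 * real k - 2 - c' * (3 - 2 / real k)"
  have "c' * (3 - 2 / real k) < cycle_exponent k * (3 - 2 / real k)"
    using c'(1) k' by (intro mult_strict_right_mono) (auto simp: field_simps)
  also have "\<dots> = 2 * real k - 2" using k' by (simp add: cycle_exponent_def field_simps)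
  finally have "0 < \<delta>" by (simp add: \<delta>_def)
  \<comment> \<open>The divisor bound adds \<open>k / r * L\<close> to the estimate of
    \<open>ln u\<close>; this \<open>r\<close> keeps that below half of the gain.\<close>
  obtain r :: nat where r: "2 * real k / \<delta> < real r" using reals_Archimedean2 by blast
  have "0 < 2 * real k / \<delta>" using \<open>0 < \<delta>\<close> k' by simp
  then have "0 < real r" using r by linarith
  have kr: "real k / real r < \<delta> / 2" using r \<open>0 < \<delta>\<close> \<open>0 < real r\<close> by (simp add: field_simps)
  obtain K :: nat where K: "K \<ge> 1" "\<And>n. n > 0 \<Longrightarrow> card {d. d dvd n} ^ r \<le> K * n"
    using card_divisors_power_le[of r] by metis
  \<comment> \<open>All terms that do not depend on \<open>m\<close>.\<close>
  define B where "B = real k / real r * ln (real K) + 2 * c' * ln 3"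
  have bounded: "\<delta> / 2 * ln (real (m - 1)) \<le> B" if "prime m" "m > 2 ^ k" for m :: nat
  proof -
    define n where "n = m - 1"
    define L where "L = ln (real n)"
    \<comment> \<open>Rounding the root down keeps \<open>X ^ k \<le> n < m\<close>, as the upper
      bound on closed walks requires; \<open>m > 2 ^ k\<close> ensures
      \<open>X \<ge> 2\<close>.\<close>
    define X where "X = nth_root_nat k n"
    have n: "2 ^ k \<le> n" "m = Suc n" using that(2) by (auto simp: n_def)
    then have "n > 0" by (metis less_le_trans zero_less_numeral zero_less_power)
    then have "L \<ge> 0" by (simp add: L_def)
    have X: "X ^ k \<le> n" "X \<ge> 2"
      using k n(1) by (auto simp: X_def nth_root_nat_power_le nth_root_nat_ge)
    have X': "n < (X + 1) ^ k"
      using k nth_root_nat_ge[of k "X + 1" n] by (fastforce simp: X_def)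
    \<comment> \<open>The maximal number of divisors up to \<open>n\<close> is attained at some
      \<open>N\<close>, and so inherits the divisor bound.\<close>
    define D where "D = Max ((\<lambda>N. card {d. d dvd N}) ` {1..n})"
    have "D \<in> (\<lambda>N. card {d. d dvd N}) ` {1..n}"
      unfolding D_def using \<open>n > 0\<close> by (intro Max_in) auto
    then obtain N where N: "N \<in> {1..n}" "D = card {d. d dvd N}" by auto
    have "{d. d dvd N} \<noteq> {}" "finite {d. d dvd N}" using N(1) by auto
    then have "D > 0" unfolding N(2) by (simp only: card_gt_0_iff) simp
    have "D ^ r \<le> K * N" unfolding N(2) using N(1) by (intro K(2)) auto
    also have "\<dots> \<le> K * n" using N(1) by simp
    finally have "real (D ^ r) \<le> real (K * n)" by (simp only: of_nat_le_iff)
    then have "ln (real D ^ r) \<le> ln (real K * real n)"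
      using \<open>D > 0\<close> \<open>n > 0\<close> K(1) by (subst ln_le_cancel_iff) auto
    then have "real r * ln (real D) \<le> ln (real K) + L"
      using \<open>D > 0\<close> \<open>n > 0\<close> K(1) by (simp add: ln_realpow ln_mult L_def)
    then have lnD: "ln (real D) \<le> (ln (real K) + L) / real r"
      using \<open>0 < real r\<close> by (simp add: field_simps)
    let ?T = "mult_graph m X"
    define s u where "s = graph_density (cycle_graph 4) ?T"
      and "u = graph_density (cycle_graph (2 * k)) ?T"
    have "pverts ?T = {1..<m}" by (simp add: mult_graph_def)
    then have T: "pair_graph ?T" "pverts ?T \<noteq> {}" "card (pverts ?T) = n"
      using \<open>n > 0\<close> n(2) by (auto simp: pair_graph_mult_graph)
    have "X < m"
    proof -
      have "X ^ 1 \<le> X ^ k" using X(2) k by (intro power_increasing) auto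
      then show ?thesis using X(1) n(2) by simp
    qed
    have s_ge: "(real X - 1)\<^sup>2 / real n ^ 3 \<le> s"
    proof -
      have "real (n * (X - 1)\<^sup>2) \<le> real (hom_count (cycle_graph 4) ?T)"
        using hom_count_cycle_4_mult_graph_ge[OF that(1) \<open>X < m\<close>] n(2)
        by (simp only: of_nat_le_iff diff_Suc_1)
      then have "real n * (real X - 1)\<^sup>2 / real n ^ 4 \<le> s"
        unfolding s_def graph_density_def using X(2) T(3) \<open>n > 0\<close>
        by (intro frac_le) (auto simp: cycle_graph_def)
      then show ?thesis using \<open>n > 0\<close> by (simp add: power4_eq_xxxx power3_eq_cube)
    qed
    have "0 < (real X - 1)\<^sup>2 / real n ^ 3" using X(2) \<open>n > 0\<close> by auto
    then have "0 < s" using s_ge by linarith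
    have "s \<le> 1"
      using hom_density_cycle_bounds[of "Graph ?T"] T(1,2) by (auto simp: s_def dest: spec[of _ 2])
    have u_le: "u \<le> real D ^ k / real n ^ (2 * k - 2)"
    proof -
      have "hom_count (cycle_graph (2 * k)) ?T \<le> (m - 1) * (X ^ k * D ^ k)"
      proof (rule hom_count_cycle_mult_graph_le[OF that(1) k])
        show "X ^ k < m" using X(1) n(2) by simp
        show "card {d. d dvd N} \<le> D" if "0 < N" "N \<le> X ^ k" for N
          unfolding D_def using that X(1) by (intro Max_ge) auto
      qed
      also have "\<dots> \<le> n * (n * D ^ k)"
        using X(1) n(2) by (intro mult_le_mono) auto
      finally have "real (hom_count (cycle_graph (2 * k)) ?T) \<le> real (n * (n * D ^ k))"
        by (simp only: of_nat_le_iff)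
      then have "u \<le> real n * (real n * real D ^ k) / real n ^ (2 * k)"
        unfolding u_def graph_density_def using T(3) \<open>n > 0\<close>
        by (intro frac_le) (auto simp: cycle_graph_def)
      also have "2 * k = 2 + (2 * k - 2)" using k by simp
      also have "real n ^ \<dots> = real n * real n * real n ^ (2 * k - 2)"
        by (simp only: power_add power2_eq_square)
      finally show ?thesis using \<open>n > 0\<close> by simp
    qed
    have "s powr c' \<le> s powr c" using \<open>0 < s\<close> \<open>s \<le> 1\<close> c'(3) by (intro powr_mono') auto
    also have "\<dots> \<le> u" unfolding s_def u_def by (intro c T)
    finally have le: "s powr c' \<le> u" .
    have "0 < s powr c'" using \<open>0 < s\<close> by simp
    with le have "0 < u" by linarith
    have "c' * ln s = ln (s powr c')" using \<open>0 < s\<close> by simp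
    also have "\<dots> \<le> ln u"
      by (rule iffD2[OF ln_le_cancel_iff]) fact+
    also have "\<dots> \<le> ln (real D ^ k / real n ^ (2 * k - 2))"
      using u_le \<open>0 < u\<close> by (subst ln_le_cancel_iff) auto
    also have "\<dots> = real k * ln (real D) - (2 * real k - 2) * L"
      using \<open>D > 0\<close> \<open>n > 0\<close> k by (simp add: ln_div ln_realpow L_def)
    also have "\<dots> \<le> real k * ((ln (real K) + L) / real r) - (2 * real k - 2) * L"
      using lnD by (intro diff_right_mono mult_left_mono) auto
    finally have upper: "c' * ln s \<le> real k / real r * (ln (real K) + L) - (2 * real k - 2) * L"
      by simp
    have "ln (real n) \<le> ln ((real X + 1) ^ k)"
    proof (subst ln_le_cancel_iff)
      have "real n \<le> real ((X + 1) ^ k)" using X' by (simp only: of_nat_le_iff)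
      then show "real n \<le> (real X + 1) ^ k" by (simp add: add.commute)
    qed (use \<open>n > 0\<close> in auto)
    then have "L / real k \<le> ln (real X + 1)"
      using k' by (simp add: L_def ln_realpow field_simps)
    \<comment> \<open>\<open>X + 1 \<le> 3 * (X - 1)\<close> holds exactly from \<open>X = 2\<close>
      on.\<close>
    also have "\<dots> \<le> ln (3 * (real X - 1))" using X(2) by (subst ln_le_cancel_iff) auto
    also have "\<dots> = ln 3 + ln (real X - 1)" using X(2) by (subst ln_mult) auto
    finally have lnX: "L / real k - ln 3 \<le> ln (real X - 1)" by simp
    have "2 * (L / real k - ln 3) - 3 * L \<le> 2 * ln (real X - 1) - 3 * L" using lnX by simp
    also have "\<dots> = ln ((real X - 1)\<^sup>2 / real n ^ 3)"
      using X(2) \<open>n > 0\<close> by (simp add: ln_div ln_realpow L_def)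
    also have "\<dots> \<le> ln s"
      using s_ge \<open>0 < s\<close> \<open>0 < (real X - 1)\<^sup>2 / real n ^ 3\<close> by (subst ln_le_cancel_iff) auto
    finally have "c' * (2 * (L / real k - ln 3) - 3 * L) \<le> c' * ln s"
      using c'(2) by (intro mult_left_mono)
    with upper have "\<delta> * L \<le> real k / real r * L + B"
      by (simp add: \<delta>_def B_def algebra_simps add_divide_distrib)
    moreover have "real k / real r * L \<le> \<delta> * L / 2"
      using mult_right_mono[OF less_imp_le[OF kr] \<open>L \<ge> 0\<close>] by simp
    ultimately have "\<delta> * L / 2 \<le> B" by linarith
    then show ?thesis by (simp add: L_def n_def)
  qed
  obtain m where m: "prime m" "m > max (2 ^ k) (nat \<lceil>exp (2 * B / \<delta>)\<rceil> + 1)"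
    using bigger_prime by blast
  have "exp (2 * B / \<delta>) < real (m - 1)" using m(2) by linarith
  then have "2 * B / \<delta> < ln (real (m - 1))"
    by (metis exp_gt_zero exp_less_cancel_iff exp_ln order.strict_trans)
  then have "B < \<delta> / 2 * ln (real (m - 1))" using \<open>0 < \<delta>\<close> by (simp add: field_simps)
  then show False using bounded[OF m(1)] m(2) by simp
qed

text \<open>The density bounds make \<open>cycle_exponent k\<close> admissible, and the
  multiplication graphs rule out anything smaller.\<close>

lemma domination_exponent_even_cycle:
  assumes "k = 2 ^ j" "k \<ge> 3"
  shows "domination_exponent (cycle_graph (2 * k)) (cycle_graph 4) = cycle_exponent k"
  unfolding domination_exponent_def
proof (rule Least_equality)
  show "\<forall>T :: nat pair_pre_digraph. pair_graph T \<and> pverts T \<noteq> {} \<longrightarrow>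
      graph_density (cycle_graph 4) T powr cycle_exponent k \<le> graph_density (cycle_graph (2 * k)) T"
  proof (intro allI impI)
    fix T :: "nat pair_pre_digraph" assume "pair_graph T \<and> pverts T \<noteq> {}"
    then have "valid_target (Graph T)" by simp
    from hom_density_cycle_bounds[OF this] obtain p where p: "0 \<le> p"
      and bounds: "\<forall>k\<ge>2. 0 \<le> graph_density (cycle_graph (2 * k)) T
        \<and> ((\<exists>j. k = 2 ^ j) \<longrightarrow> p ^ (2 * k) \<le> graph_density (cycle_graph (2 * k)) T)
        \<and> graph_density (cycle_graph 4) T ^ (k - 1)
            \<le> p ^ (k - 2) * graph_density (cycle_graph (2 * k)) T"
      by auto
    from bounds[rule_format, of 2] bounds[rule_format, of k]
    show "graph_density (cycle_graph 4) T powr cycle_exponent k \<le> graph_density (cycle_graph (2 * k)) T"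
      using assms by (intro density_bounds_domination[OF assms(2) _ p]) auto
  qed
next
  fix c assume "\<forall>T :: nat pair_pre_digraph. pair_graph T \<and> pverts T \<noteq> {} \<longrightarrow>
      graph_density (cycle_graph 4) T powr c \<le> graph_density (cycle_graph (2 * k)) T"
  then show "cycle_exponent k \<le> c" using assms(2) by (intro domination_exponent_ge) auto
qed

section \<open>Pigeonhole over the powers of two\<close>

theorem theorem2p6:
  fixes N :: nat and T :: "nat \<Rightarrow> nat \<Rightarrow> 'b target"
  assumes "\<And>i n. 1 \<le> i \<Longrightarrow> i \<le> N \<Longrightarrow> 1 \<le> n \<Longrightarrow> valid_target (T i n)"
  shows "\<exists>G H. even_cycle G \<and> even_cycle H \<and>
           (\<forall>i. 1 \<le> i \<and> i \<le> N \<longrightarrow>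
              \<not> (\<lambda>n. ln (hom_density G (T i n)) / ln (hom_density H (T i n)))
                  \<longlonglongrightarrow> domination_exponent G H)"
proof (rule ccontr)
  assume contra: "\<not> ?thesis"
  \<comment> \<open>Powers of two starting at 4, so that the bounds requiring
    \<open>k \<ge> 3\<close> apply.\<close>
  define K where "K j = (2::nat) ^ (j + 2)" for j
  have K: "K j \<ge> 3" for j
  proof -
    have "4 \<le> K j" by (simp add: K_def)
    then show ?thesis by linarith
  qed
  define good where "good i j \<longleftrightarrow> (\<lambda>n. ln (hom_density (cycle_graph (2 * K j)) (T i n))
      / ln (hom_density (cycle_graph 4) (T i n))) \<longlonglongrightarrow> cycle_exponent (K j)" for i j
  have "\<exists>i\<in>{1..N}. good i j" for j
  proof -
    have "even_cycle (cycle_graph (2 * K j))"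
      unfolding even_cycle_def using K[of j] by (intro exI[of _ "K j"]) auto
    moreover have "even_cycle (cycle_graph 4)"
      unfolding even_cycle_def by (intro exI[of _ 2]) auto
    ultimately have "\<not> (\<forall>i. 1 \<le> i \<and> i \<le> N \<longrightarrow>
        \<not> (\<lambda>n. ln (hom_density (cycle_graph (2 * K j)) (T i n)) / ln (hom_density (cycle_graph 4) (T i n)))
          \<longlonglongrightarrow> domination_exponent (cycle_graph (2 * K j)) (cycle_graph 4))"
      using contra by blast
    then show ?thesis
      unfolding domination_exponent_even_cycle[OF K_def K] good_def by auto
  qed
  then obtain i where i: "\<And>j. i j \<in> {1..N}" "\<And>j. good (i j) j" by metis
  \<comment> \<open>\<open>N + 1\<close> values of \<open>j\<close> share \<open>N\<close>
    sequences, so one sequence is extremal for two different cycles.\<close>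
  have "\<not> inj_on i {..N}"
  proof
    assume "inj_on i {..N}"
    then have "card {..N} \<le> card {1..N}" using i(1) by (intro card_inj_on_le[of i]) auto
    then show False by simp
  qed
  then obtain j j' where j: "j \<noteq> j'" "i j = i j'" by (auto simp: inj_on_def)
  define \<tau> where "\<tau> = T (i j)"
  have "valid_target (\<tau> n)" if "n \<ge> 1" for n
    using assms i(1)[of j] that by (auto simp: \<tau>_def)
  note hom_density_cycle_bounds[OF this]
  then obtain p where p: "\<And>n. n \<ge> 1 \<Longrightarrow> 0 \<le> p n \<and>
      (\<forall>k\<ge>2. 0 \<le> hom_density (cycle_graph (2 * k)) (\<tau> n) \<and> hom_density (cycle_graph (2 * k)) (\<tau> n) \<le> 1
        \<and> ((\<exists>j. k = 2 ^ j) \<longrightarrow> p n ^ (2 * k) \<le> hom_density (cycle_graph (2 * k)) (\<tau> n))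
        \<and> hom_density (cycle_graph 4) (\<tau> n) ^ (k - 1)
            \<le> p n ^ (k - 2) * hom_density (cycle_graph (2 * k)) (\<tau> n))"
    by metis
  \<comment> \<open>Since \<open>p n\<close> depends on the target alone and not on
    \<open>l\<close>, every extremal \<open>l\<close> prescribes a limit for the same
    quotient.\<close>
  have lim: "(\<lambda>n. ln (p n) / ln (hom_density (cycle_graph 4) (\<tau> n)))
      \<longlonglongrightarrow> (real (K l) - 1) / (3 * real (K l) - 2)" if "good (i j) l" for l
  proof (rule edge_exponent_tendsto[OF K])
    show "(\<lambda>n. ln (hom_density (cycle_graph (2 * K l)) (\<tau> n)) / ln (hom_density (cycle_graph 4) (\<tau> n)))
        \<longlonglongrightarrow> cycle_exponent (K l)"
      using that by (simp add: good_def \<tau>_def)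
    fix n :: nat assume "n \<ge> 1"
    have "K l \<ge> 2" "\<exists>j. K l = 2 ^ j" using K[of l] by (simp, unfold K_def, blast)
    then show "0 \<le> hom_density (cycle_graph 4) (\<tau> n) \<and> hom_density (cycle_graph 4) (\<tau> n) \<le> 1
        \<and> 0 \<le> p n \<and> 0 \<le> hom_density (cycle_graph (2 * K l)) (\<tau> n)
        \<and> p n ^ (2 * K l) \<le> hom_density (cycle_graph (2 * K l)) (\<tau> n)
        \<and> hom_density (cycle_graph 4) (\<tau> n) ^ (K l - 1)
            \<le> p n ^ (K l - 2) * hom_density (cycle_graph (2 * K l)) (\<tau> n)"
      using p[OF \<open>n \<ge> 1\<close>, THEN conjunct2, rule_format, of 2]
        p[OF \<open>n \<ge> 1\<close>, THEN conjunct2, rule_format, of "K l"] p[OF \<open>n \<ge> 1\<close>] by auto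
  qed
  have "(real (K j) - 1) / (3 * real (K j) - 2) = (real (K j') - 1) / (3 * real (K j') - 2)"
    using lim[of j] lim[of j'] i(2)[of j] i(2)[of j'] j(2) by (intro LIMSEQ_unique) auto
  moreover have "real (K j) \<ge> 3" "real (K j') \<ge> 3" using K[of j] K[of j'] by auto
  \<comment> \<open>Cross-multiplying shows that \<open>(x - 1) / (3 * x - 2)\<close> is injective
    for \<open>x \<ge> 3\<close>.\<close>
  ultimately have "real (K j) = real (K j')" by (simp add: field_simps)
  then show False using j(1) by (simp add: K_def)
qed

end
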